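(* Let $\varepsilon\in\{1,-1\}$ and consider the Cauchy problem $$\big(u_t+u_{xxx}+uu_x+u_{xx}+u_{xxxx}+(u^2)_{xx}\big)_x+\varepsilon u_{yy}=0,\qquad u(x,y,0)=\varphi(x,y),\quad (x,y)\in\mathbb{R}^2,\ t\ge 0.$$ Let $s<-1/2$. Then there does not exist a time $T>0$ such that this problem admits a unique solution in $C([0,T];H^{s,0}(\mathbb{R}^2))$ for every initial datum $\varphi$ in some ball of $H^{s,0}$ centered at the origin and such that the map $\varphi\mapsto u$ is $C^2$-differentiable at the origin from $H^{s,0}$ to $C([0,T];H^{s,0})$.
   Context: Notation: $\langle a\rangle=1+|a|$; $\zeta=(\xi,\eta)$ is dual to $(x,y)$. $H^{s_1,s_2}(\mathbb{R}^2)$ consists of $f\in\mathcal{S}'(\mathbb{R}^2)$ with $\|f\|_{H^{s_1,s_2}}=\|\langle\xi\rangle^{s_1}\langle\eta\rangle^{s_2}\widehat f(\xi,\eta)\|_{L^2}<\infty$. Let $P(\zeta)=\xi^3-\varepsilon\eta^2/\xi$, $\varrho(\xi)=\xi^4-\xi^2$, and let $W(t)$, $t\ge 0$, be defined by $(W(t)f)^{\wedge}(\zeta)=\exp(itP(\zeta)-t\varrho(\xi))\widehat f(\zeta)$; let $\Lambda=\tfrac12\partial_x+\partial_x^2$. A solution means a function satisfying $u(t)=W(t)\varphi-\int_0^tW(t-t')\Lambda(u^2(t'))\,dt'$. *)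

theory Defs
  imports "HOL-Analysis.Analysis"
begin

text \<open>Everything is written on the Fourier side: a (tempered) function f on R^2 is
represented by its Fourier transform, a function of zeta = (xi, eta).
Convention: hat f(zeta) = integral of exp(-i x.zeta) f(x) dx, so that
d/dx corresponds to multiplication by i*xi and the Fourier transform of f*g is
(2 pi)^(-2) times the convolution of the Fourier transforms.\<close>

type_synonym fhat = "real \<times> real \<Rightarrow> complex"
type_synonym tfhat = "real \<Rightarrow> real \<times> real \<Rightarrow> complex"

definition jap :: "real \<Rightarrow> real" where
  "jap a = 1 + \<bar>a\<bar>"

definition Psym :: "real \<Rightarrow> real \<times> real \<Rightarrow> real" where
  "Psym \<epsilon> \<zeta> = fst \<zeta> ^ 3 - \<epsilon> * snd \<zeta> ^ 2 / fst \<zeta>"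

definition rho :: "real \<Rightarrow> real" where
  "rho \<xi> = \<xi> ^ 4 - \<xi> ^ 2"

definition Wsym :: "real \<Rightarrow> real \<Rightarrow> real \<times> real \<Rightarrow> complex" where
  "Wsym \<epsilon> t \<zeta> = exp (\<i> * of_real (t * Psym \<epsilon> \<zeta>) - of_real (t * rho (fst \<zeta>)))"

text \<open>Symbol of Lambda = 1/2 d_x + d_x^2.\<close>
definition Lsym :: "real \<times> real \<Rightarrow> complex" where
  "Lsym \<zeta> = \<i> * of_real (fst \<zeta> / 2) - of_real (fst \<zeta> ^ 2)"

definition Hs :: "real \<Rightarrow> fhat set" where
  "Hs s = {f. f \<in> borel_measurable lborel \<and>
      integrable lborel (\<lambda>\<zeta>. jap (fst \<zeta>) powr (2 * s) * (cmod (f \<zeta>))\<^sup>2)}"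

definition hnorm :: "real \<Rightarrow> fhat \<Rightarrow> real" where
  "hnorm s f = sqrt (LINT \<zeta>|lborel. jap (fst \<zeta>) powr (2 * s) * (cmod (f \<zeta>))\<^sup>2)"

definition CTH :: "real \<Rightarrow> real \<Rightarrow> tfhat set" where
  "CTH s T = {u. (\<forall>t\<in>{0..T}. u t \<in> Hs s) \<and>
      (\<forall>t\<in>{0..T}. ((\<lambda>t'. hnorm s (\<lambda>\<zeta>. u t' \<zeta> - u t \<zeta>)) \<longlongrightarrow> 0) (at t within {0..T}))}"

definition cnorm :: "real \<Rightarrow> real \<Rightarrow> tfhat \<Rightarrow> real" where
  "cnorm s T u = (SUP t\<in>{0..T}. hnorm s (u t))"

definition sqhat :: "fhat \<Rightarrow> fhat" where
  "sqhat f \<zeta> = of_real (1 / (4 * pi ^ 2)) * (LINT \<zeta>'|lborel. f (\<zeta> - \<zeta>') * f \<zeta>')"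

definition is_solution :: "real \<Rightarrow> real \<Rightarrow> fhat \<Rightarrow> tfhat \<Rightarrow> bool" where
  "is_solution \<epsilon> T \<phi> u \<longleftrightarrow> (\<forall>t\<in>{0..T}. AE \<zeta> in lborel.
      (AE t' in lborel. t' \<in> {0..t} \<longrightarrow> integrable lborel (\<lambda>\<zeta>'. u t' (\<zeta> - \<zeta>') * u t' \<zeta>')) \<and>
      set_integrable lborel {0..t} (\<lambda>t'. Wsym \<epsilon> (t - t') \<zeta> * Lsym \<zeta> * sqhat (u t') \<zeta>) \<and>
      u t \<zeta> = Wsym \<epsilon> t \<zeta> * \<phi> \<zeta>
               - set_lebesgue_integral lborel {0..t} (\<lambda>t'. Wsym \<epsilon> (t - t') \<zeta> * Lsym \<zeta> * sqhat (u t') \<zeta>))"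

text \<open>Bounded real-linear operators H^{s,0} -> C([0,T];H^{s,0}) (identities modulo
  norm-zero elements).\<close>
definition lin_bounded :: "real \<Rightarrow> real \<Rightarrow> (fhat \<Rightarrow> tfhat) \<Rightarrow> bool" where
  "lin_bounded s T L \<longleftrightarrow> (\<forall>h\<in>Hs s. L h \<in> CTH s T) \<and>
     (\<forall>a b::real. \<forall>f\<in>Hs s. \<forall>g\<in>Hs s.
        cnorm s T (\<lambda>t \<zeta>. L (\<lambda>\<zeta>. of_real a * f \<zeta> + of_real b * g \<zeta>) t \<zeta>
                        - of_real a * L f t \<zeta> - of_real b * L g t \<zeta>) = 0) \<and>
     (\<exists>C. \<forall>h\<in>Hs s. cnorm s T (L h) \<le> C * hnorm s h)"

definition has_fderiv_H :: "real \<Rightarrow> real \<Rightarrow> (fhat \<Rightarrow> tfhat) \<Rightarrow> (fhat \<Rightarrow> tfhat) \<Rightarrow> fhat \<Rightarrow> bool" where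
  "has_fderiv_H s T S L \<phi>0 \<longleftrightarrow> lin_bounded s T L \<and>
     (\<forall>e>0. \<exists>d>0. \<forall>h\<in>Hs s. hnorm s h < d \<longrightarrow>
        cnorm s T (\<lambda>t \<zeta>. S (\<lambda>\<zeta>. \<phi>0 \<zeta> + h \<zeta>) t \<zeta> - S \<phi>0 t \<zeta> - L h t \<zeta>) \<le> e * hnorm s h)"

text \<open>S is twice Frechet differentiable at the origin: it is Frechet differentiable on a
  ball of radius rr (contained in the ball of radius r where S is given), and its
  derivative DS is Frechet differentiable at 0 (as a map into bounded operators),
  with derivative a bounded bilinear map B.\<close>
definition twice_diff_at0 :: "real \<Rightarrow> real \<Rightarrow> real \<Rightarrow> (fhat \<Rightarrow> tfhat) \<Rightarrow> bool" where
  "twice_diff_at0 s T r S \<longleftrightarrow> (\<exists>rr>0. rr \<le> r \<and> (\<exists>DS.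
     (\<forall>\<phi>\<in>Hs s. hnorm s \<phi> < rr \<longrightarrow> has_fderiv_H s T S (DS \<phi>) \<phi>) \<and>
     (\<exists>B. (\<forall>\<phi>\<in>Hs s. lin_bounded s T (B \<phi>)) \<and>
          (\<forall>a b::real. \<forall>f\<in>Hs s. \<forall>g\<in>Hs s. \<forall>h\<in>Hs s.
             cnorm s T (\<lambda>t \<zeta>. B (\<lambda>\<zeta>. of_real a * f \<zeta> + of_real b * g \<zeta>) h t \<zeta>
                             - of_real a * B f h t \<zeta> - of_real b * B g h t \<zeta>) = 0) \<and>
          (\<exists>C. \<forall>\<phi>\<in>Hs s. \<forall>h\<in>Hs s. cnorm s T (B \<phi> h) \<le> C * hnorm s \<phi> * hnorm s h) \<and>
          (\<forall>e>0. \<exists>d>0. \<forall>\<phi>\<in>Hs s. hnorm s \<phi> < d \<longrightarrow> (\<forall>h\<in>Hs s.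
             cnorm s T (\<lambda>t \<zeta>. DS \<phi> h t \<zeta> - DS (\<lambda>_. 0) h t \<zeta> - B \<phi> h t \<zeta>)
               \<le> e * hnorm s \<phi> * hnorm s h)))))"

end

theory Submission
  imports Defs "HOL-Probability.Sinc_Integral"
begin

text \<open>Negative regularity makes \<open>u\<^sup>2\<close> discontinuous on \<open>H\<^sup>s\<close>, so the equation for an abstract
  solution cannot be expanded directly. Instead, for data with \<open>\<xi> \<ge> N \<ge> 2\<close> a small solution
  is built by Picard iteration below a multiple of a majorant that is stable under convolution;
  uniqueness identifies it with \<open>S \<phi>\<close>. For \<open>\<xi> < 3 N\<close> this solution is exactly quadratic in
  the datum, since cubic terms only see \<open>\<xi> \<ge> 3 N\<close>. Twice differentiability then bounds the
  second Picard iterate by \<open>C \<parallel>\<phi>\<parallel>\<^sup>2\<close>. For \<open>\<phi>\<close> the indicator of \<open>[N, 2 N] \<times> [0, N\<^sup>2]\<close> and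
  time \<open>N\<^sup>-\<^sup>4\<close> there is no cancellation in that iterate, and comparing both sides gives
  \<open>1 \<le> C N\<^sup>1\<^sup>+\<^sup>2\<^sup>s\<close>, which is absurd for large \<open>N\<close>.\<close>

section \<open>The weighted spaces\<close>

text \<open>The quadratic coefficient is tested on a box inside 2 N < \<xi> < 3 N. There the datum
  vanishes, so the linear term drops out too and the dependence on the amplitude is a pure square:
  no remainder of the Picard series has to be estimated in H^s, where squaring is not controlled.
  The powers of N come from the following count. The datum box has area N^3, so its squared norm is
  about N^(2s+3). At time N^-4, the time scale of the dissipation \<xi>^4, the second iterate has
  size at least of order N^2 (symbol of \<Lambda>) times N^-4 (time) times N^3 (overlap of the
  boxes), that is N, on a box of area of order N^3; this contributes N^(2s+5) to its squared norm.
  The fourth power of the norm of the datum allows only N^(4s+6). The height N^2 keeps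
  \<eta>^2/\<xi> no larger than \<xi>^3, so over that time the whole phase is O(1/N) for either sign
  of \<epsilon>.\<close>

lemma jap_pos: "jap a > 0"
  by (simp add: jap_def add_pos_nonneg)

lemma measurable_jap [measurable]: "jap \<in> borel_measurable borel"
  unfolding jap_def [abs_def] by measurable

lemma HsD:
  assumes "f \<in> Hs s"
  shows "f \<in> borel_measurable borel"
    and "integrable lborel (\<lambda>\<zeta>. jap (fst \<zeta>) powr (2 * s) * (cmod (f \<zeta>))\<^sup>2)"
  using assms by (auto simp: Hs_def)

lemma hnorm_nonneg: "hnorm s f \<ge> 0"
  unfolding hnorm_def by (intro real_sqrt_ge_zero integral_nonneg_AE) auto

lemma hnorm_power2:
  "(hnorm s f)\<^sup>2 = (LINT \<zeta>|lborel. jap (fst \<zeta>) powr (2 * s) * (cmod (f \<zeta>))\<^sup>2)"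
  unfolding hnorm_def by (subst real_sqrt_pow2) (auto intro!: integral_nonneg_AE)

lemma Hs_dominated:
  assumes "g \<in> Hs s" "f \<in> borel_measurable borel" "AE \<zeta> in lborel. cmod (f \<zeta>) \<le> cmod (g \<zeta>)"
  shows "f \<in> Hs s"
proof -
  have "integrable lborel (\<lambda>\<zeta>. jap (fst \<zeta>) powr (2 * s) * (cmod (f \<zeta>))\<^sup>2)"
  proof (rule Bochner_Integration.integrable_bound [OF HsD(2) [OF assms(1)]])
    show "(\<lambda>\<zeta>. jap (fst \<zeta>) powr (2 * s) * (cmod (f \<zeta>))\<^sup>2) \<in> borel_measurable lborel"
      using assms(2) by (simp add: borel_prod [symmetric])
    show "AE \<zeta> in lborel. norm (jap (fst \<zeta>) powr (2 * s) * (cmod (f \<zeta>))\<^sup>2)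
        \<le> norm (jap (fst \<zeta>) powr (2 * s) * (cmod (g \<zeta>))\<^sup>2)"
      using assms(3) by eventually_elim (auto intro!: mult_left_mono power_mono)
  qed
  then show ?thesis using assms(2) by (simp add: Hs_def)
qed

lemma hnorm_mono:
  assumes "g \<in> Hs s" "f \<in> borel_measurable borel" "AE \<zeta> in lborel. cmod (f \<zeta>) \<le> cmod (g \<zeta>)"
  shows "hnorm s f \<le> hnorm s g"
  unfolding hnorm_def
proof (intro real_sqrt_le_mono integral_mono_AE HsD(2) assms Hs_dominated [OF assms])
  show "AE \<zeta> in lborel. jap (fst \<zeta>) powr (2 * s) * (cmod (f \<zeta>))\<^sup>2
      \<le> jap (fst \<zeta>) powr (2 * s) * (cmod (g \<zeta>))\<^sup>2"
    using assms(3) by eventually_elim (auto intro!: mult_left_mono power_mono)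
qed

lemma Hs_scale:
  assumes "f \<in> Hs s"
  shows "(\<lambda>\<zeta>. c * f \<zeta>) \<in> Hs s"
proof -
  have "integrable lborel (\<lambda>\<zeta>. (cmod c)\<^sup>2 * (jap (fst \<zeta>) powr (2 * s) * (cmod (f \<zeta>))\<^sup>2))"
    using HsD(2) [OF assms] by simp
  then have "integrable lborel (\<lambda>\<zeta>. jap (fst \<zeta>) powr (2 * s) * (cmod (c * f \<zeta>))\<^sup>2)"
    by (simp add: norm_mult power_mult_distrib mult_ac)
  then show ?thesis using HsD(1) [OF assms] by (simp add: Hs_def)
qed

lemma hnorm_scale: "hnorm s (\<lambda>\<zeta>. c * f \<zeta>) = cmod c * hnorm s f"
proof -
  have "(hnorm s (\<lambda>\<zeta>. c * f \<zeta>))\<^sup>2 =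
      (LINT \<zeta>|lborel. (cmod c)\<^sup>2 * (jap (fst \<zeta>) powr (2 * s) * (cmod (f \<zeta>))\<^sup>2))"
    unfolding hnorm_power2 by (simp add: norm_mult power_mult_distrib mult_ac)
  also have "\<dots> = (cmod c * hnorm s f)\<^sup>2"
    by (simp add: power_mult_distrib hnorm_power2)
  finally show ?thesis
    by (simp add: hnorm_nonneg)
qed

lemma cmod_add_power2_le: "(cmod (a + b))\<^sup>2 \<le> 2 * (cmod a)\<^sup>2 + 2 * (cmod b)\<^sup>2"
proof -
  have "(cmod (a + b))\<^sup>2 \<le> (cmod a + cmod b)\<^sup>2"
    by (intro power_mono norm_triangle_ineq) auto
  also have "\<dots> \<le> 2 * (cmod a)\<^sup>2 + 2 * (cmod b)\<^sup>2"
    using sum_squares_bound [of "cmod a" "cmod b"] by (simp add: power2_sum)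
  finally show ?thesis .
qed

text \<open>The factor 2 comes from the pointwise bound on the square of a sum and replaces
  Minkowski's inequality. It is harmless below: it meets quantities that tend to 0, or it is
  absorbed by a constant.\<close>

lemma
  assumes f: "f \<in> Hs s" and g: "g \<in> Hs s"
  shows Hs_add: "(\<lambda>\<zeta>. f \<zeta> + g \<zeta>) \<in> Hs s"
    and hnorm_add_le: "hnorm s (\<lambda>\<zeta>. f \<zeta> + g \<zeta>) \<le> 2 * (hnorm s f + hnorm s g)"
proof -
  let ?w = "\<lambda>\<zeta>::real \<times> real. jap (fst \<zeta>) powr (2 * s)"
  have le: "?w \<zeta> * (cmod (f \<zeta> + g \<zeta>))\<^sup>2 \<le>
      2 * (?w \<zeta> * (cmod (f \<zeta>))\<^sup>2) + 2 * (?w \<zeta> * (cmod (g \<zeta>))\<^sup>2)" for \<zeta>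
    using mult_left_mono [OF cmod_add_power2_le [of "f \<zeta>" "g \<zeta>"], of "?w \<zeta>"]
    by (simp add: algebra_simps)
  have m: "(\<lambda>\<zeta>. f \<zeta> + g \<zeta>) \<in> borel_measurable borel"
    using HsD(1) f g by measurable
  have i2: "integrable lborel (\<lambda>\<zeta>. 2 * (?w \<zeta> * (cmod (f \<zeta>))\<^sup>2) + 2 * (?w \<zeta> * (cmod (g \<zeta>))\<^sup>2))"
    by (intro Bochner_Integration.integrable_add integrable_mult_right HsD(2) f g)
  have i: "integrable lborel (\<lambda>\<zeta>. ?w \<zeta> * (cmod (f \<zeta> + g \<zeta>))\<^sup>2)"
  proof (rule Bochner_Integration.integrable_bound [OF i2])
    show "(\<lambda>\<zeta>. ?w \<zeta> * (cmod (f \<zeta> + g \<zeta>))\<^sup>2) \<in> borel_measurable lborel"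
      using m by (simp add: borel_prod [symmetric])
  qed (use le in auto)
  then show "(\<lambda>\<zeta>. f \<zeta> + g \<zeta>) \<in> Hs s"
    using m by (simp add: Hs_def)
  have "(hnorm s (\<lambda>\<zeta>. f \<zeta> + g \<zeta>))\<^sup>2 \<le>
      (LINT \<zeta>|lborel. 2 * (?w \<zeta> * (cmod (f \<zeta>))\<^sup>2) + 2 * (?w \<zeta> * (cmod (g \<zeta>))\<^sup>2))"
    unfolding hnorm_power2 by (intro integral_mono i i2 le)
  also have "\<dots> = 2 * (hnorm s f)\<^sup>2 + 2 * (hnorm s g)\<^sup>2"
    using HsD(2) [OF f] HsD(2) [OF g] by (simp add: hnorm_power2)
  also have "\<dots> \<le> (2 * (hnorm s f + hnorm s g))\<^sup>2"
    using hnorm_nonneg [of s f] hnorm_nonneg [of s g]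
    by (simp add: power2_eq_square algebra_simps)
  finally show "hnorm s (\<lambda>\<zeta>. f \<zeta> + g \<zeta>) \<le> 2 * (hnorm s f + hnorm s g)"
    by (rule power2_le_imp_le) (simp add: hnorm_nonneg)
qed

lemma Hs_diff:
  assumes "f \<in> Hs s" "g \<in> Hs s"
  shows "(\<lambda>\<zeta>. f \<zeta> - g \<zeta>) \<in> Hs s"
  using Hs_add [OF assms(1) Hs_scale [OF assms(2), of "-1"]] by simp

lemma hnorm_eq_0_AE:
  assumes "f \<in> Hs s" "hnorm s f = 0"
  shows "AE \<zeta> in lborel. f \<zeta> = 0"
proof -
  have "(LINT \<zeta>|lborel. jap (fst \<zeta>) powr (2 * s) * (cmod (f \<zeta>))\<^sup>2) = 0"
    using assms(2) hnorm_power2 [of s f] by simp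
  then have "AE \<zeta> in lborel. jap (fst \<zeta>) powr (2 * s) * (cmod (f \<zeta>))\<^sup>2 = 0"
    by (subst (asm) integral_nonneg_eq_0_iff_AE) (use HsD(2) [OF assms(1)] in auto)
  then show ?thesis
    by eventually_elim (use jap_pos [THEN less_imp_neq] in auto)
qed

lemma hnorm_zero: "hnorm s (\<lambda>_. 0) = 0"
  by (simp add: hnorm_def)

section \<open>Continuous curves in the weighted space\<close>

lemma CTH_Hs: "u \<in> CTH s T \<Longrightarrow> t \<in> {0..T} \<Longrightarrow> u t \<in> Hs s"
  by (simp add: CTH_def)

lemma CTH_scale:
  assumes "u \<in> CTH s T"
  shows "(\<lambda>t \<zeta>. c * u t \<zeta>) \<in> CTH s T"
proof -
  have "((\<lambda>t'. hnorm s (\<lambda>\<zeta>. c * u t' \<zeta> - c * u t \<zeta>)) \<longlongrightarrow> 0) (at t within {0..T})"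
    if "t \<in> {0..T}" for t
  proof -
    have "((\<lambda>t'. cmod c * hnorm s (\<lambda>\<zeta>. u t' \<zeta> - u t \<zeta>)) \<longlongrightarrow> 0) (at t within {0..T})"
      using assms that by (intro tendsto_mult_right_zero) (auto simp: CTH_def)
    then show ?thesis
      by (simp add: hnorm_scale [symmetric] right_diff_distrib)
  qed
  then show ?thesis
    using assms by (auto simp: CTH_def intro: Hs_scale)
qed

lemma CTH_add:
  assumes u: "u \<in> CTH s T" and v: "v \<in> CTH s T"
  shows "(\<lambda>t \<zeta>. u t \<zeta> + v t \<zeta>) \<in> CTH s T"
proof -
  have "((\<lambda>t'. hnorm s (\<lambda>\<zeta>. (u t' \<zeta> + v t' \<zeta>) - (u t \<zeta> + v t \<zeta>))) \<longlongrightarrow> 0) (at t within {0..T})"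
    if t: "t \<in> {0..T}" for t
  proof (rule tendsto_sandwich [where f = "\<lambda>_. 0"])
    let ?b = "\<lambda>t'. 2 * (hnorm s (\<lambda>\<zeta>. u t' \<zeta> - u t \<zeta>) + hnorm s (\<lambda>\<zeta>. v t' \<zeta> - v t \<zeta>))"
    have "(?b \<longlongrightarrow> 2 * (0 + 0)) (at t within {0..T})"
      using u v t by (intro tendsto_intros) (auto simp: CTH_def)
    then show "(?b \<longlongrightarrow> 0) (at t within {0..T})" by simp
    show "\<forall>\<^sub>F t' in at t within {0..T}.
        hnorm s (\<lambda>\<zeta>. (u t' \<zeta> + v t' \<zeta>) - (u t \<zeta> + v t \<zeta>)) \<le> ?b t'"
      unfolding eventually_at_filter
    proof (rule always_eventually, intro allI impI)
      fix t' assume "t' \<noteq> t" "t' \<in> {0..T}"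
      then show "hnorm s (\<lambda>\<zeta>. (u t' \<zeta> + v t' \<zeta>) - (u t \<zeta> + v t \<zeta>)) \<le> ?b t'"
        using hnorm_add_le [OF Hs_diff [OF CTH_Hs [OF u] CTH_Hs [OF u], of t' t]
            Hs_diff [OF CTH_Hs [OF v] CTH_Hs [OF v], of t' t]] t
        by (simp add: algebra_simps)
    qed
    show "\<forall>\<^sub>F t' in at t within {0..T}.
        0 \<le> hnorm s (\<lambda>\<zeta>. (u t' \<zeta> + v t' \<zeta>) - (u t \<zeta> + v t \<zeta>))"
      by (intro always_eventually allI hnorm_nonneg)
  qed simp
  then show ?thesis
    using u v by (auto simp: CTH_def intro: Hs_add)
qed

lemma CTH_diff:
  assumes "u \<in> CTH s T" "v \<in> CTH s T"
  shows "(\<lambda>t \<zeta>. u t \<zeta> - v t \<zeta>) \<in> CTH s T"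
  using CTH_add [OF assms(1) CTH_scale [OF assms(2), of "-1"]] by simp

text \<open>\<open>cnorm\<close> is a supremum of reals and carries information only for a set
  bounded above. Compactness of the time interval gives this: finitely many times come within
  distance 1 of all values of the curve, and \<open>hnorm_add_le\<close> does the rest.\<close>

lemma CTH_bdd_above:
  assumes u: "u \<in> CTH s T"
  shows "bdd_above ((\<lambda>t. hnorm s (u t)) ` {0..T})"
proof -
  have "\<exists>d>0. \<forall>t'\<in>{0..T}. dist t' t < d \<longrightarrow> hnorm s (\<lambda>\<zeta>. u t' \<zeta> - u t \<zeta>) < 1"
    if t: "t \<in> {0..T}" for t
  proof -
    have "((\<lambda>t'. hnorm s (\<lambda>\<zeta>. u t' \<zeta> - u t \<zeta>)) \<longlongrightarrow> 0) (at t within {0..T})"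
      using u t by (simp add: CTH_def)
    then have "\<forall>\<^sub>F t' in at t within {0..T}. hnorm s (\<lambda>\<zeta>. u t' \<zeta> - u t \<zeta>) < 1"
      by (rule order_tendstoD) simp
    then obtain d where "d > 0"
      "\<forall>t'\<in>{0..T}. t' \<noteq> t \<and> dist t' t < d \<longrightarrow> hnorm s (\<lambda>\<zeta>. u t' \<zeta> - u t \<zeta>) < 1"
      by (auto simp: eventually_at)
    then show ?thesis
      by (intro exI [of _ d]) (auto simp: hnorm_zero intro: ccontr)
  qed
  then obtain d where d: "\<And>t. t \<in> {0..T} \<Longrightarrow> d t > 0"
    "\<And>t t'. t \<in> {0..T} \<Longrightarrow> t' \<in> {0..T} \<Longrightarrow> dist t' t < d t \<Longrightarrow>
      hnorm s (\<lambda>\<zeta>. u t' \<zeta> - u t \<zeta>) < 1"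
    by metis
  have "compact {0..T}" by simp
  moreover have "{0..T} \<subseteq> (\<Union>t\<in>{0..T}. ball t (d t))"
    using d(1) by force
  ultimately obtain F where F: "F \<subseteq> {0..T}" "finite F" "{0..T} \<subseteq> (\<Union>t\<in>F. ball t (d t))"
    using compactE_image [of "{0..T}" "{0..T}" "\<lambda>t. ball t (d t)"] by (metis open_ball)
  show ?thesis
  proof (rule bdd_aboveI2)
    fix t assume t: "t \<in> {0..T}"
    then obtain t0 where t0: "t0 \<in> F" "dist t t0 < d t0"
      using F(3) by (auto simp: dist_commute)
    with F(1) have t0': "t0 \<in> {0..T}" by auto
    have "hnorm s (u t) \<le> 2 * (hnorm s (\<lambda>\<zeta>. u t \<zeta> - u t0 \<zeta>) + hnorm s (u t0))"
      using hnorm_add_le [OF Hs_diff [OF CTH_Hs [OF u t] CTH_Hs [OF u t0']] CTH_Hs [OF u t0']]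
      by simp
    also have "\<dots> \<le> 2 * (1 + (\<Sum>t\<in>F. hnorm s (u t)))"
      using d(2) [OF t0' t t0(2)] member_le_sum [of t0 F "\<lambda>t. hnorm s (u t)"] t0(1) F(2)
      by (auto simp: hnorm_nonneg)
    finally show "hnorm s (u t) \<le> 2 * (1 + (\<Sum>t\<in>F. hnorm s (u t)))" .
  qed
qed

lemma hnorm_le_cnorm:
  assumes "u \<in> CTH s T" "t \<in> {0..T}"
  shows "hnorm s (u t) \<le> cnorm s T u"
  unfolding cnorm_def by (rule cSUP_upper [OF assms(2) CTH_bdd_above [OF assms(1)]])

section \<open>The second derivative at the origin\<close>

text \<open>The solution is explicit only on part of frequency space. Localising the norm there
  keeps its unknown values elsewhere out of the difference quotients.\<close>

definition rnorm :: "real \<Rightarrow> (real \<times> real) set \<Rightarrow> fhat \<Rightarrow> real" where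
  "rnorm s E f = hnorm s (\<lambda>\<zeta>. indicator E \<zeta> * f \<zeta>)"

lemma Hs_indicator:
  assumes "f \<in> Hs s" "E \<in> sets borel"
  shows "(\<lambda>\<zeta>. indicator E \<zeta> * f \<zeta>) \<in> Hs s"
  using HsD(1) [OF assms(1)] assms(2)
  by (intro Hs_dominated [OF assms(1)]) (auto simp: indicator_def norm_mult intro!: always_eventually)

lemma rnorm_nonneg: "rnorm s E f \<ge> 0"
  by (simp add: rnorm_def hnorm_nonneg)

lemma rnorm_le_hnorm:
  assumes "f \<in> Hs s" "E \<in> sets borel"
  shows "rnorm s E f \<le> hnorm s f"
  unfolding rnorm_def using HsD(1) [OF assms(1)] assms(2)
  by (intro hnorm_mono [OF assms(1)]) (auto simp: indicator_def norm_mult intro!: always_eventually)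

lemma rnorm_add_le:
  assumes "f \<in> Hs s" "g \<in> Hs s" "E \<in> sets borel"
  shows "rnorm s E (\<lambda>\<zeta>. f \<zeta> + g \<zeta>) \<le> 2 * (rnorm s E f + rnorm s E g)"
  using hnorm_add_le [OF Hs_indicator Hs_indicator, OF assms(1,3,2,3)]
  by (simp add: rnorm_def distrib_left)

lemma rnorm_scale: "rnorm s E (\<lambda>\<zeta>. c * f \<zeta>) = cmod c * rnorm s E f"
  unfolding rnorm_def hnorm_scale [symmetric] by (simp add: mult_ac)

lemma rnorm_cong_AE:
  assumes "f \<in> Hs s" "g \<in> Hs s" "E \<in> sets borel" "AE \<zeta> in lborel. \<zeta> \<in> E \<longrightarrow> f \<zeta> = g \<zeta>"
  shows "rnorm s E f = rnorm s E g"
proof (rule antisym)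
  show "rnorm s E f \<le> rnorm s E g"
    unfolding rnorm_def
    using HsD(1) [OF Hs_indicator [OF assms(1,3)]] assms(4)
    by (intro hnorm_mono Hs_indicator assms) (auto simp: indicator_def elim: eventually_mono)
  show "rnorm s E g \<le> rnorm s E f"
    unfolding rnorm_def
    using HsD(1) [OF Hs_indicator [OF assms(2,3)]] assms(4)
    by (intro hnorm_mono Hs_indicator assms) (auto simp: indicator_def elim: eventually_mono)
qed

text \<open>The form in which the Frechet estimates arrive: an arbitrary e times a constant that
  does not depend on e.\<close>

lemma eq_0_if_le_scaled:
  fixes x c :: real
  assumes "0 \<le> x" "\<And>e. e > 0 \<Longrightarrow> x \<le> e * c"
  shows "x = 0"
proof (rule ccontr)
  assume "x \<noteq> 0"
  with assms(1) have x: "x > 0" by simp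
  with assms(2) [of 1] have c: "c > 0" by simp
  show False
    using assms(2) [of "x / (2 * c)"] x c by (simp add: field_simps)
qed

text \<open>Linearity is available only modulo norm zero, so homogeneity is itself an identity of
  norms; it is the linear combination whose second coefficient is 0.\<close>

lemma lin_bounded_scale:
  assumes L: "lin_bounded s T L" and h: "h \<in> Hs s" and t: "t \<in> {0..T}"
  shows "hnorm s (\<lambda>\<zeta>. L (\<lambda>\<zeta>. of_real \<tau> * h \<zeta>) t \<zeta> - of_real \<tau> * L h t \<zeta>) = 0"
proof -
  have eq: "cnorm s T (\<lambda>t \<zeta>. L (\<lambda>\<zeta>. of_real \<tau> * h \<zeta> + of_real 0 * h \<zeta>) t \<zeta>
      - of_real \<tau> * L h t \<zeta> - of_real 0 * L h t \<zeta>) = 0"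
    using L h unfolding lin_bounded_def by blast
  have "(\<lambda>t \<zeta>. L (\<lambda>\<zeta>. of_real \<tau> * h \<zeta>) t \<zeta> - of_real \<tau> * L h t \<zeta>) \<in> CTH s T"
    using L h Hs_scale [OF h] by (intro CTH_diff CTH_scale) (auto simp: lin_bounded_def)
  from hnorm_le_cnorm [OF this t] eq show ?thesis
    by (simp add: order_antisym [OF _ hnorm_nonneg])
qed

text \<open>The derivative of \<open>\<delta> \<mapsto> S (\<delta> h)\<close> is read off on \<open>E\<close> from the explicit
  quadratic, so that only difference quotients of \<open>DS\<close>, and no mean value theorem in
  \<open>C([0,T];H\<^sup>s)\<close>, are needed.\<close>
lemma second_order_bound:
  assumes S2: "twice_diff_at0 s T r S"
    and SC: "\<And>\<phi>. \<phi> \<in> Hs s \<Longrightarrow> hnorm s \<phi> < r \<Longrightarrow> S \<phi> \<in> CTH s T"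
  obtains C where "\<And>h a E t \<delta>\<^sub>0. \<lbrakk>h \<in> Hs s; t \<in> {0..T}; E \<in> sets borel; a \<in> Hs s; \<delta>\<^sub>0 > 0;
      \<And>\<delta>::real. \<bar>\<delta>\<bar> < \<delta>\<^sub>0 \<Longrightarrow>
        AE \<zeta> in lborel. \<zeta> \<in> E \<longrightarrow> S (\<lambda>\<zeta>. of_real \<delta> * h \<zeta>) t \<zeta> = of_real (\<delta>\<^sup>2) * a \<zeta>;
      \<And>\<zeta>. \<zeta> \<notin> E \<Longrightarrow> a \<zeta> = 0\<rbrakk> \<Longrightarrow> hnorm s a \<le> C * (hnorm s h)\<^sup>2"
proof -
  from S2 obtain rr DS B C where rr: "rr > 0" "rr \<le> r"
    and DS: "\<And>\<phi>. \<phi> \<in> Hs s \<Longrightarrow> hnorm s \<phi> < rr \<Longrightarrow> has_fderiv_H s T S (DS \<phi>) \<phi>"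
    and Blin: "\<And>\<phi>. \<phi> \<in> Hs s \<Longrightarrow> lin_bounded s T (B \<phi>)"
    and Badd: "\<And>a b f g h. f \<in> Hs s \<Longrightarrow> g \<in> Hs s \<Longrightarrow> h \<in> Hs s \<Longrightarrow>
        cnorm s T (\<lambda>t \<zeta>. B (\<lambda>\<zeta>. of_real a * f \<zeta> + of_real b * g \<zeta>) h t \<zeta>
                             - of_real a * B f h t \<zeta> - of_real b * B g h t \<zeta>) = 0"
    and Bbd: "\<And>\<phi> h. \<phi> \<in> Hs s \<Longrightarrow> h \<in> Hs s \<Longrightarrow> cnorm s T (B \<phi> h) \<le> C * hnorm s \<phi> * hnorm s h"
    and DDS: "\<And>e. e > 0 \<Longrightarrow> \<exists>d>0. \<forall>\<phi>\<in>Hs s. hnorm s \<phi> < d \<longrightarrow> (\<forall>h\<in>Hs s.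
             cnorm s T (\<lambda>t \<zeta>. DS \<phi> h t \<zeta> - DS (\<lambda>_. 0) h t \<zeta> - B \<phi> h t \<zeta>)
               \<le> e * hnorm s \<phi> * hnorm s h)"
    unfolding twice_diff_at0_def
    apply (elim exE conjE)
    subgoal premises prems for rr DS B C
      by (rule that [of rr DS B C]) (use prems in \<open>simp_all\<close>)
    done
  show ?thesis
  proof (rule that)
    fix h a :: fhat and E :: "(real \<times> real) set" and t \<delta>0 :: real
    assume h: "h \<in> Hs s" and t: "t \<in> {0..T}" and E: "E \<in> sets borel" and a: "a \<in> Hs s"
      and \<delta>0: "\<delta>0 > 0"
      and Seq: "\<And>\<delta>::real. \<bar>\<delta>\<bar> < \<delta>0 \<Longrightarrow>
        AE \<zeta> in lborel. \<zeta> \<in> E \<longrightarrow> S (\<lambda>\<zeta>. of_real \<delta> * h \<zeta>) t \<zeta> = of_real (\<delta>\<^sup>2) * a \<zeta>"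
      and aE: "\<And>\<zeta>. \<zeta> \<notin> E \<Longrightarrow> a \<zeta> = 0"
    let ?p = "rnorm s E"
    define nh where "nh = hnorm s h"
    have nh: "nh \<ge> 0" by (simp add: nh_def hnorm_nonneg)
    define dh :: "real \<Rightarrow> fhat" where "dh = (\<lambda>\<delta> \<zeta>. of_real \<delta> * h \<zeta>)"
    have dh: "dh \<delta> \<in> Hs s" for \<delta> unfolding dh_def by (rule Hs_scale [OF h])
    have ndh: "hnorm s (dh \<delta>) = \<bar>\<delta>\<bar> * nh" for \<delta>
      by (simp add: dh_def hnorm_scale nh_def)
    \<comment> \<open>The second bound keeps \<delta> h in the ball where \<open>S\<close> is
      differentiable; \<open>nh + 1\<close> avoids a division by zero when h has norm 0.\<close>
    define \<delta>1 where "\<delta>1 = min \<delta>0 (rr / (nh + 1))"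
    have \<delta>1: "\<delta>1 > 0" using \<delta>0 rr nh by (simp add: \<delta>1_def)
    have small: "x * nh < y" if "y > 0" "0 \<le> x" "x \<le> y / (nh + 1)" for x y
    proof -
      have "x * (nh + 1) \<le> y" using that(3) nh by (simp add: field_simps)
      then show ?thesis using that nh by (cases "x = 0") (auto simp: algebra_simps)
    qed
    have inball: "hnorm s (dh \<delta>) < rr" if "\<bar>\<delta>\<bar> < \<delta>1" for \<delta>
      unfolding ndh using that rr by (intro small) (auto simp: \<delta>1_def)
    define D where "D = (\<lambda>\<delta>. DS (dh \<delta>) h t)"
    have lin: "lin_bounded s T (DS (dh \<delta>))" if "\<bar>\<delta>\<bar> < \<delta>1" for \<delta>
      using DS [OF dh inball [OF that]] by (simp add: has_fderiv_H_def)
    have D: "D \<delta> \<in> Hs s" if "\<bar>\<delta>\<bar> < \<delta>1" for \<delta>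
      using lin [OF that] h t by (auto simp: D_def lin_bounded_def intro: CTH_Hs)
    \<comment> \<open>On E the curve \<delta> \<mapsto> S (\<delta> h) is \<delta>^2 a, with
      derivative 2 \<delta> a; this must be the Frechet derivative at \<delta> h in direction
      h.\<close>
    have stepA: "?p (\<lambda>\<zeta>. of_real (2 * \<delta>) * a \<zeta> - D \<delta> \<zeta>) = 0" if \<delta>: "\<bar>\<delta>\<bar> < \<delta>1" for \<delta>
    proof (rule eq_0_if_le_scaled [OF rnorm_nonneg])
      fix e :: real assume e: "e > 0"
      obtain d where d: "d > 0" "\<And>k. k \<in> Hs s \<Longrightarrow> hnorm s k < d \<Longrightarrow>
          cnorm s T (\<lambda>t \<zeta>. S (\<lambda>\<zeta>. dh \<delta> \<zeta> + k \<zeta>) t \<zeta> - S (dh \<delta>) t \<zeta> - DS (dh \<delta>) k t \<zeta>)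
            \<le> e * hnorm s k"
        using DS [OF dh inball [OF \<delta>], unfolded has_fderiv_H_def, THEN conjunct2, rule_format, OF e]
        by blast
      \<comment> \<open>The three bounds serve, in order, the error \<tau> a of the difference
        quotient, the admissibility of \<delta> + \<tau>, and the size required of the increment
        \<tau> h.\<close>
      define \<tau> where "\<tau> = min (min e ((\<delta>1 - \<bar>\<delta>\<bar>) / 2)) (d / (nh + 1))"
      have \<tau>: "\<tau> > 0" "\<tau> \<le> e" "\<tau> \<le> (\<delta>1 - \<bar>\<delta>\<bar>) / 2" "\<tau> \<le> d / (nh + 1)"
        using e d \<delta> nh by (simp_all add: \<tau>_def min_le_iff_disj del: le_divide_eq_numeral1)
      have \<delta>\<tau>: "\<bar>\<delta> + \<tau>\<bar> < \<delta>1"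
        using abs_triangle_ineq [of \<delta> \<tau>] \<tau>(1,3) \<delta> by (simp add: field_simps)
      have sum: "(\<lambda>\<zeta>. dh \<delta> \<zeta> + dh \<tau> \<zeta>) = dh (\<delta> + \<tau>)"
        by (simp add: dh_def fun_eq_iff algebra_simps)
      define X where "X = (\<lambda>\<zeta>. S (dh (\<delta> + \<tau>)) t \<zeta> - S (dh \<delta>) t \<zeta> - DS (dh \<delta>) (dh \<tau>) t \<zeta>)"
      define Y where "Y = (\<lambda>\<zeta>. DS (dh \<delta>) (dh \<tau>) t \<zeta> - of_real \<tau> * D \<delta> \<zeta>)"
      have SCTH: "S (dh \<delta>') \<in> CTH s T" if "\<bar>\<delta>'\<bar> < \<delta>1" for \<delta>'
        using SC [OF dh] inball [OF that] rr by simp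
      have DCTH: "DS (dh \<delta>) (dh \<tau>) \<in> CTH s T" "DS (dh \<delta>) h \<in> CTH s T"
        using lin [OF \<delta>] dh h by (auto simp: lin_bounded_def)
      have XC: "(\<lambda>t \<zeta>. S (dh (\<delta> + \<tau>)) t \<zeta> - S (dh \<delta>) t \<zeta> - DS (dh \<delta>) (dh \<tau>) t \<zeta>) \<in> CTH s T"
        by (intro CTH_diff SCTH DCTH \<delta> \<delta>\<tau>)
      have XH: "X \<in> Hs s" unfolding X_def by (rule CTH_Hs [OF XC t])
      have YH: "Y \<in> Hs s" unfolding Y_def
        by (intro Hs_diff Hs_scale D \<delta> CTH_Hs [OF DCTH(1) t])
      have "hnorm s X \<le> e * hnorm s (dh \<tau>)"
      proof (rule order_trans [OF hnorm_le_cnorm [OF XC t, folded X_def]])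
        have "hnorm s (dh \<tau>) < d"
          using small [OF d(1), of \<tau>] \<tau> by (simp add: ndh)
        from d(2) [OF dh this, unfolded sum]
        show "cnorm s T (\<lambda>t \<zeta>. S (dh (\<delta> + \<tau>)) t \<zeta> - S (dh \<delta>) t \<zeta> - DS (dh \<delta>) (dh \<tau>) t \<zeta>)
            \<le> e * hnorm s (dh \<tau>)" .
      qed
      with rnorm_le_hnorm [OF XH E] have X: "?p X \<le> e * \<tau> * nh"
        using \<tau> by (simp add: ndh)
      have "hnorm s Y = 0"
        using lin_bounded_scale [OF lin [OF \<delta>] h t, of \<tau>] by (simp add: Y_def D_def dh_def)
      with rnorm_le_hnorm [OF YH E] have Y: "?p Y \<le> 0" by simp
      have S\<delta>: "AE \<zeta> in lborel. \<zeta> \<in> E \<longrightarrow> S (dh \<delta>) t \<zeta> = of_real (\<delta>\<^sup>2) * a \<zeta>"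
        using Seq [of \<delta>] \<delta> by (simp add: dh_def \<delta>1_def)
      have S\<tau>: "AE \<zeta> in lborel. \<zeta> \<in> E \<longrightarrow> S (dh (\<delta> + \<tau>)) t \<zeta> = of_real ((\<delta> + \<tau>)\<^sup>2) * a \<zeta>"
        using Seq [of "\<delta> + \<tau>"] \<delta>\<tau> by (simp add: dh_def \<delta>1_def)
      \<comment> \<open>The quotient ((\<delta> + \<tau>)^2 - \<delta>^2) / \<tau> is 2 \<delta> +
        \<tau>, whence the correction by -\<tau> a. \<open>X\<close> is the Frechet remainder and
        \<open>Y\<close> the defect of homogeneity.\<close>
      have "?p (\<lambda>\<zeta>. of_real (2 * \<delta>) * a \<zeta> - D \<delta> \<zeta>) =
          ?p (\<lambda>\<zeta>. of_real (1 / \<tau>) * (X \<zeta> + Y \<zeta>) + of_real (- \<tau>) * a \<zeta>)"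
      proof (rule rnorm_cong_AE [OF _ _ E])
        show "AE \<zeta> in lborel. \<zeta> \<in> E \<longrightarrow> of_real (2 * \<delta>) * a \<zeta> - D \<delta> \<zeta> =
            of_real (1 / \<tau>) * (X \<zeta> + Y \<zeta>) + of_real (- \<tau>) * a \<zeta>"
          using S\<delta> S\<tau>
        proof eventually_elim
          case (elim \<zeta>)
          then show ?case
            using \<tau>(1) by (auto simp: X_def Y_def field_simps power2_eq_square)
        qed
      qed (intro Hs_add Hs_diff Hs_scale XH YH a D \<delta>)+
      also have "\<dots> \<le> 2 * (1 / \<tau> * ?p (\<lambda>\<zeta>. X \<zeta> + Y \<zeta>) + \<tau> * ?p a)"
        using rnorm_add_le [OF Hs_scale [OF Hs_add [OF XH YH]] Hs_scale [OF a] E,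
            of "of_real (1 / \<tau>)" "of_real (- \<tau>)"] \<tau>(1)
        by (simp only: rnorm_scale norm_of_real) simp
      also have "\<dots> \<le> 2 * (1 / \<tau> * (2 * (e * \<tau> * nh + 0)) + e * ?p a)"
        using rnorm_add_le [OF XH YH E] X Y \<tau> rnorm_nonneg [of s E a]
        by (intro mult_left_mono add_mono mult_right_mono) auto
      also have "\<dots> = e * (4 * nh + 2 * ?p a)"
        using \<tau>(1) by (simp add: field_simps)
      finally show "?p (\<lambda>\<zeta>. of_real (2 * \<delta>) * a \<zeta> - D \<delta> \<zeta>) \<le> e * (4 * nh + 2 * ?p a)" .
    qed
    define Bh where "Bh = B h h t"
    have BhC: "B h h \<in> CTH s T" using Blin [OF h] h by (simp add: lin_bounded_def)
    then have BhH: "Bh \<in> Hs s" using t by (simp add: Bh_def CTH_Hs)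
    have dh0: "dh 0 = (\<lambda>_. 0)" by (simp add: dh_def)
    \<comment> \<open>At \<delta> = 0 the first derivative in direction h vanishes on E.\<close>
    have D0: "?p (D 0) = 0"
      using stepA [of 0] \<delta>1 rnorm_scale [of s E "-1" "D 0"] by simp
    \<comment> \<open>Differentiating 2 \<delta> a once more at 0 identifies 2 a with
      \<open>B h h\<close> on E. The pieces \<open>U\<close>, \<open>Z\<close>, \<open>V\<close> and
      \<open>D 0\<close> telescope to \<delta> (2 a - \<open>Bh\<close>), and only the remainder
      \<open>Z\<close> is not null on E.\<close>
    have "?p (\<lambda>\<zeta>. of_real 2 * a \<zeta> - Bh \<zeta>) = 0"
    proof (rule eq_0_if_le_scaled [OF rnorm_nonneg])
      fix e :: real assume e: "e > 0"
      obtain d where d: "d > 0" "\<And>\<phi>. \<phi> \<in> Hs s \<Longrightarrow> hnorm s \<phi> < d \<Longrightarrow>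
          cnorm s T (\<lambda>t \<zeta>. DS \<phi> h t \<zeta> - DS (\<lambda>_. 0) h t \<zeta> - B \<phi> h t \<zeta>) \<le> e * hnorm s \<phi> * hnorm s h"
        using DDS [OF e] h by blast
      define \<delta> where "\<delta> = min (\<delta>1 / 2) (d / (nh + 1))"
      have \<delta>: "\<delta> > 0" "\<bar>\<delta>\<bar> < \<delta>1" "\<delta> \<le> d / (nh + 1)"
        using d \<delta>1 nh by (auto simp: \<delta>_def)
      define Z where "Z = (\<lambda>\<zeta>. D \<delta> \<zeta> - D 0 \<zeta> - B (dh \<delta>) h t \<zeta>)"
      define V where "V = (\<lambda>\<zeta>. B (dh \<delta>) h t \<zeta> - of_real \<delta> * Bh \<zeta>)"
      define U where "U = (\<lambda>\<zeta>. of_real (2 * \<delta>) * a \<zeta> - D \<delta> \<zeta>)"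
      have C1: "DS (dh \<delta>) h \<in> CTH s T" "DS (dh 0) h \<in> CTH s T" "B (dh \<delta>) h \<in> CTH s T"
        using lin [OF \<delta>(2)] lin [of 0] \<delta>1 h Blin [OF dh] by (auto simp: lin_bounded_def)
      have D0H: "D 0 \<in> Hs s" using D \<delta>1 by simp
      have UH: "U \<in> Hs s" unfolding U_def by (intro Hs_diff Hs_scale a D \<delta>)
      have VC: "(\<lambda>t \<zeta>. B (dh \<delta>) h t \<zeta> - of_real \<delta> * B h h t \<zeta>) \<in> CTH s T"
        by (intro CTH_diff CTH_scale C1 BhC)
      have VH: "V \<in> Hs s" unfolding V_def Bh_def by (rule CTH_Hs [OF VC t])
      have ZC: "(\<lambda>t \<zeta>. DS (dh \<delta>) h t \<zeta> - DS (dh 0) h t \<zeta> - B (dh \<delta>) h t \<zeta>) \<in> CTH s T"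
        by (intro CTH_diff C1)
      have ZH: "Z \<in> Hs s" unfolding Z_def D_def by (rule CTH_Hs [OF ZC t])
      have "hnorm s Z \<le> e * hnorm s (dh \<delta>) * nh"
        unfolding Z_def D_def
      proof (rule order_trans [OF hnorm_le_cnorm [OF ZC t]])
        have "hnorm s (dh \<delta>) < d"
          using small [OF d(1), of \<delta>] \<delta> by (simp add: ndh)
        from d(2) [OF dh this, folded dh0 nh_def]
        show "cnorm s T (\<lambda>t \<zeta>. DS (dh \<delta>) h t \<zeta> - DS (dh 0) h t \<zeta> - B (dh \<delta>) h t \<zeta>)
            \<le> e * hnorm s (dh \<delta>) * nh" .
      qed
      with rnorm_le_hnorm [OF ZH E] have Z: "?p Z \<le> e * \<delta> * nh\<^sup>2"
        using \<delta> by (simp add: ndh power2_eq_square mult_ac)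
      have "cnorm s T (\<lambda>t \<zeta>. B (\<lambda>\<zeta>. of_real \<delta> * h \<zeta> + of_real 0 * h \<zeta>) h t \<zeta>
          - of_real \<delta> * B h h t \<zeta> - of_real 0 * B h h t \<zeta>) = 0"
        by (rule Badd [OF h h h])
      then have "hnorm s V \<le> 0"
        using hnorm_le_cnorm [OF VC t] by (simp add: V_def Bh_def dh_def)
      with rnorm_le_hnorm [OF VH E] have V: "?p V \<le> 0" by simp
      have "\<delta> * ?p (\<lambda>\<zeta>. of_real 2 * a \<zeta> - Bh \<zeta>) = ?p (\<lambda>\<zeta>. of_real \<delta> * (of_real 2 * a \<zeta> - Bh \<zeta>))"
        unfolding rnorm_scale using \<delta> by simp
      also have "(\<lambda>\<zeta>. of_real \<delta> * (of_real 2 * a \<zeta> - Bh \<zeta>)) = (\<lambda>\<zeta>. (U \<zeta> + Z \<zeta>) + (V \<zeta> + D 0 \<zeta>))"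
        by (simp add: U_def Z_def V_def algebra_simps)
      also have "?p \<dots> \<le> 2 * (2 * (?p U + ?p Z) + 2 * (?p V + ?p (D 0)))"
        using rnorm_add_le [OF Hs_add [OF UH ZH] Hs_add [OF VH D0H] E]
          rnorm_add_le [OF UH ZH E] rnorm_add_le [OF VH D0H E] by simp
      also have "\<dots> \<le> 4 * (e * \<delta> * nh\<^sup>2)"
        using stepA [OF \<delta>(2)] Z V D0 by (simp add: U_def)
      finally have "\<delta> * ?p (\<lambda>\<zeta>. of_real 2 * a \<zeta> - Bh \<zeta>) \<le> \<delta> * (e * (4 * nh\<^sup>2))"
        by (simp add: mult_ac)
      then show "?p (\<lambda>\<zeta>. of_real 2 * a \<zeta> - Bh \<zeta>) \<le> e * (4 * nh\<^sup>2)"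
        using \<delta>(1) by simp
    qed
    \<comment> \<open>The 2 lost in \<open>rnorm_add_le\<close> is the 2 in front of a, so the
      constant stays the \<open>C\<close> that bounds \<open>B\<close>.\<close>
    then have "?p (\<lambda>\<zeta>. of_real 2 * a \<zeta>) \<le> 2 * ?p Bh"
      using rnorm_add_le [OF Hs_diff [OF Hs_scale [OF a] BhH] BhH E, of "of_real 2"] by simp
    also have "?p Bh \<le> C * nh\<^sup>2"
      using rnorm_le_hnorm [OF BhH E] hnorm_le_cnorm [OF BhC t] Bbd [OF h h]
      by (simp add: Bh_def nh_def power2_eq_square)
    finally have "?p a \<le> C * nh\<^sup>2"
      by (simp only: rnorm_scale) simp
    moreover have "(\<lambda>\<zeta>. indicator E \<zeta> * a \<zeta>) = a"
      by (rule ext) (metis aE indicator_simps mult_1 mult_zero_left)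
    ultimately show "hnorm s a \<le> C * (hnorm s h)\<^sup>2"
      by (simp add: rnorm_def nh_def)
  qed
qed

section \<open>Symbols and the convolution majorant\<close>

lemma measurable_fst_borel [measurable]: "(fst :: real \<times> real \<Rightarrow> real) \<in> borel_measurable borel"
  by (simp add: borel_prod [symmetric])

lemma measurable_snd_borel [measurable]: "(snd :: real \<times> real \<Rightarrow> real) \<in> borel_measurable borel"
  by (simp add: borel_prod [symmetric])

lemma measurable_Psym [measurable]: "Psym \<epsilon> \<in> borel_measurable borel"
  unfolding Psym_def [abs_def] by measurable

lemma measurable_rho [measurable]: "rho \<in> borel_measurable borel"
  unfolding rho_def [abs_def] by measurable

lemma measurable_Lsym [measurable]: "Lsym \<in> borel_measurable borel"
  unfolding Lsym_def [abs_def] by measurable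

lemma measurable_Wsym [measurable (raw)]:
  assumes [measurable]: "f \<in> borel_measurable M" "g \<in> M \<rightarrow>\<^sub>M borel"
  shows "(\<lambda>x. Wsym \<epsilon> (f x) (g x)) \<in> borel_measurable M"
  unfolding Wsym_def by measurable

lemma Wsym_add: "Wsym \<epsilon> (a + b) \<zeta> = Wsym \<epsilon> a \<zeta> * Wsym \<epsilon> b \<zeta>"
  by (simp add: Wsym_def exp_add [symmetric] algebra_simps)

lemma norm_Wsym: "cmod (Wsym \<epsilon> t \<zeta>) = exp (- t * rho (fst \<zeta>))"
  by (simp add: Wsym_def)

text \<open>From frequency 2 on the dissipation beats the bound 2 \<xi>^2 for the symbol of
  \<Lambda>. For 0 < \<bar>\<xi>\<bar> < 1 it is negative and the propagator grows, which is why
  data are kept above a frequency N \<ge> 2.\<close>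

lemma rho_ge: "\<xi> \<ge> 2 \<Longrightarrow> 3 * \<xi>\<^sup>2 \<le> rho \<xi>"
proof -
  assume "\<xi> \<ge> 2"
  then have "2\<^sup>2 \<le> \<xi>\<^sup>2" by (intro power_mono) auto
  then have "4 * \<xi>\<^sup>2 \<le> \<xi>\<^sup>2 * \<xi>\<^sup>2" by (intro mult_right_mono) auto
  then show ?thesis by (simp add: rho_def power4_eq_xxxx power2_eq_square mult_ac)
qed

lemma norm_Wsym_le_1: "fst \<zeta> \<ge> 2 \<Longrightarrow> t \<ge> 0 \<Longrightarrow> cmod (Wsym \<epsilon> t \<zeta>) \<le> 1"
  using rho_ge [of "fst \<zeta>"] by (simp add: norm_Wsym) (meson mult_nonneg_nonneg order_trans zero_le_power2 mult_nonneg_nonneg zero_le_numeral)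

lemma norm_Lsym_le:
  assumes "fst \<zeta> \<ge> 2"
  shows "cmod (Lsym \<zeta>) \<le> 2 * (fst \<zeta>)\<^sup>2"
proof -
  have "cmod (Lsym \<zeta>) \<le> fst \<zeta> / 2 + (fst \<zeta>)\<^sup>2"
    unfolding Lsym_def using assms norm_triangle_ineq4 [of "\<i> * of_real (fst \<zeta> / 2)" "of_real (fst \<zeta> ^ 2)"]
    by (simp add: norm_mult norm_power)
  also have "fst \<zeta> / 2 \<le> (fst \<zeta>)\<^sup>2"
    using assms mult_mono [of 2 "fst \<zeta>" "fst \<zeta>" "fst \<zeta>"] by (simp add: power2_eq_square)
  finally show ?thesis by simp
qed

text \<open>The bound is uniform in t, so the iteration needs small data but no short time, and the
  T of the theorem can be taken as given.\<close>

lemma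
  assumes "c > 0" "t \<ge> (0::real)"
  shows set_integrable_exp: "set_integrable lborel {0..t} (\<lambda>t'. exp (- (t - t') * c))"
    and set_integral_exp_le: "(LINT t':{0..t}|lborel. exp (- (t - t') * c)) \<le> 1 / c"
proof -
  have "has_bochner_integral lborel (\<lambda>x. exp (- (t - x) * c) * indicator {0..t} x)
     (exp (- (t - t) * c) / c - exp (- (t - 0) * c) / c)"
    using assms by (intro has_bochner_integral_FTC_Icc_nonneg) (auto intro!: derivative_eq_intros)
  then have *: "has_bochner_integral lborel (\<lambda>x. indicator {0..t} x *\<^sub>R exp (- (t - x) * c))
     (exp (- (t - t) * c) / c - exp (- (t - 0) * c) / c)"
    by (simp add: mult.commute)
  then show "set_integrable lborel {0..t} (\<lambda>t'. exp (- (t - t') * c))"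
    unfolding set_integrable_def by (rule integrable.intros)
  show "(LINT t':{0..t}|lborel. exp (- (t - t') * c)) \<le> 1 / c"
    unfolding set_lebesgue_integral_def has_bochner_integral_integral_eq [OF *]
    using assms by simp
qed

lemma set_integrable_bounded:
  fixes q :: "real \<Rightarrow> complex"
  assumes [measurable]: "q \<in> borel_measurable borel" and "\<And>x. x \<in> {a..b} \<Longrightarrow> cmod (q x) \<le> M"
  shows "set_integrable lborel {a..b} q"
  unfolding set_integrable_def
proof (rule Bochner_Integration.integrable_bound)
  show "integrable lborel (\<lambda>x. indicator {a..b} x * M :: real)"
    by (intro integrable_mult_left integrable_real_indicator) (auto simp: emeasure_lborel_Icc_eq)
  show "AE x in lborel. norm (indicator {a..b} x *\<^sub>R q x) \<le> norm (indicator {a..b} x * M)"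
    using assms(2) by (intro always_eventually) (force simp: indicator_def)
qed measurable

text \<open>The Cauchy density without its factor 1/\<pi>. Polynomial decay is the point: the
  convolution of this function with itself lies below a multiple of it, whereas a Gaussian would
  spread out.\<close>

definition lor :: "real \<Rightarrow> real" where "lor x = inverse (1 + x\<^sup>2)"

definition maj :: "real \<times> real \<Rightarrow> real" where "maj \<zeta> = lor (fst \<zeta>) * lor (snd \<zeta>)"

lemma lor_pos: "lor x > 0" and lor_le_1: "lor x \<le> 1"
  by (auto simp: lor_def add_pos_nonneg inverse_le_1_iff)

lemma measurable_lor [measurable]: "lor \<in> borel_measurable borel"
  unfolding lor_def [abs_def] by measurable

lemma measurable_maj [measurable]: "maj \<in> borel_measurable borel"
  unfolding maj_def [abs_def] by measurable

lemma maj_pos: "maj \<zeta> > 0" and maj_le_1: "maj \<zeta> \<le> 1"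
  using lor_pos lor_le_1 by (auto simp: maj_def mult_le_one less_imp_le)

lemma integrable_lor: "integrable lborel lor"
  using integrable_inverse_1_plus_square by (simp add: set_integrable_def lor_def [abs_def] UNIV_def [symmetric])

text \<open>One of y and x - y is at least half as large as x, so one of the two factors already
  decays like \<open>lor x\<close> and the other remains for the integration.\<close>

lemma lor_mult_le: "lor (x - y) * lor y \<le> 2 * lor x * (lor (x - y) + lor y)"
proof -
  have *: "inverse c * inverse b \<le> 2 * inverse a * (inverse c + inverse b)"
    if "a \<le> 2 * (b + c)" "a > 0" "b > 0" "c > 0" for a b c :: real
    using that by (simp add: field_simps)
  \<comment> \<open>This square is 2 y^2 + 2 (x - y)^2 - x^2.\<close>
  have "0 \<le> (x - 2 * y)\<^sup>2" by simp
  then have "1 + x\<^sup>2 \<le> 2 * ((1 + y\<^sup>2) + (1 + (x - y)\<^sup>2))"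
    by (simp add: power2_eq_square algebra_simps)
  then show ?thesis
    unfolding lor_def by (rule *) (simp_all add: add_pos_nonneg)
qed

lemma
  fixes f g :: "real \<Rightarrow> real"
  assumes f: "integrable lborel f" and g: "integrable lborel g"
  shows integrable_tensor: "integrable lborel (\<lambda>\<zeta>. f (fst \<zeta>) * g (snd \<zeta>))"
    and integral_tensor: "(LINT \<zeta>|lborel. f (fst \<zeta>) * g (snd \<zeta>)) = (LINT x|lborel. f x) * (LINT y|lborel. g y)"
proof -
  have [measurable]: "f \<in> borel_measurable borel" "g \<in> borel_measurable borel"
    using f g by auto
  have i: "integrable (lborel \<Otimes>\<^sub>M lborel) (\<lambda>\<zeta>. f (fst \<zeta>) * g (snd \<zeta>))"
    by (rule lborel_pair.Fubini_integrable) (use f g in \<open>auto simp: abs_mult\<close>)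
  then show "integrable lborel (\<lambda>\<zeta>. f (fst \<zeta>) * g (snd \<zeta>))"
    by (simp add: lborel_prod)
  show "(LINT \<zeta>|lborel. f (fst \<zeta>) * g (snd \<zeta>)) = (LINT x|lborel. f x) * (LINT y|lborel. g y)"
    using lborel_pair.integral_fst' [OF i] by (simp add: lborel_prod)
qed

lemma
  shows integrable_lor_shift: "integrable lborel (\<lambda>y. lor (x - y) + lor y)"
    and integral_lor_shift: "(LINT y|lborel. lor (x - y) + lor y) = 2 * (LINT y|lborel. lor y)"
  using lborel_integrable_real_affine [OF integrable_lor, of "-1" x] integrable_lor
    lborel_integral_real_affine [of "-1" lor x]
  by simp_all

text \<open>\<open>lor_mult_le\<close> in each coordinate pulls \<open>maj \<zeta>\<close> out of
  the convolution; what remains has an integral independent of \<zeta>, by translation and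
  reflection invariance.\<close>

lemma maj_conv:
  obtains K where "K > 0"
    "\<And>\<zeta>. integrable lborel (\<lambda>\<zeta>'. maj (\<zeta> - \<zeta>') * maj \<zeta>')"
    "\<And>\<zeta>. (LINT \<zeta>'|lborel. maj (\<zeta> - \<zeta>') * maj \<zeta>') \<le> K * maj \<zeta>"
proof -
  define I where "I = (LINT y|lborel. lor y)"
  define \<Phi> where "\<Phi> = (\<lambda>\<zeta> \<zeta>'. (lor (fst \<zeta> - fst \<zeta>') + lor (fst \<zeta>')) * (lor (snd \<zeta> - snd \<zeta>') + lor (snd \<zeta>')))"
  have le: "maj (\<zeta> - \<zeta>') * maj \<zeta>' \<le> 4 * maj \<zeta> * \<Phi> \<zeta> \<zeta>'" for \<zeta> \<zeta>'
    using mult_mono [OF lor_mult_le [of "fst \<zeta>" "fst \<zeta>'"] lor_mult_le [of "snd \<zeta>" "snd \<zeta>'"]]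
    by (simp add: maj_def \<Phi>_def lor_pos less_imp_le add_nonneg_nonneg algebra_simps)
  have i: "integrable lborel (\<Phi> \<zeta>)" and v: "(LINT \<zeta>'|lborel. \<Phi> \<zeta> \<zeta>') = (2 * I)\<^sup>2" for \<zeta>
    unfolding \<Phi>_def I_def
    by (rule integrable_tensor [OF integrable_lor_shift integrable_lor_shift],
        simp add: integral_tensor [OF integrable_lor_shift integrable_lor_shift] integral_lor_shift power2_eq_square)
  have i2: "integrable lborel (\<lambda>\<zeta>'. maj (\<zeta> - \<zeta>') * maj \<zeta>')" for \<zeta>
    by (rule Bochner_Integration.integrable_bound [OF integrable_mult_right [OF i, of "4 * maj \<zeta>" \<zeta>]])
       (use order_trans [OF le abs_ge_self] in \<open>auto simp: abs_mult maj_pos less_imp_le\<close>)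
  \<comment> \<open>16 I^2 is 4 (2 I)^2; adding 1 makes the constant visibly positive.\<close>
  have "(LINT \<zeta>'|lborel. maj (\<zeta> - \<zeta>') * maj \<zeta>') \<le> (16 * I\<^sup>2 + 1) * maj \<zeta>" for \<zeta>
  proof -
    have "(LINT \<zeta>'|lborel. maj (\<zeta> - \<zeta>') * maj \<zeta>') \<le> (LINT \<zeta>'|lborel. 4 * maj \<zeta> * \<Phi> \<zeta> \<zeta>')"
      by (intro integral_mono i2 integrable_mult_right i le)
    also have "\<dots> \<le> (16 * I\<^sup>2 + 1) * maj \<zeta>"
      using maj_pos [of \<zeta>] by (simp add: v power2_eq_square algebra_simps)
    finally show ?thesis .
  qed
  then show ?thesis
    using that [of "16 * I\<^sup>2 + 1"] i2 by (simp add: add_nonneg_pos)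
qed

text \<open>For s \<le> 0 the weight is at most 1, and \<open>maj\<close> is at most 1, so the
  integrability of \<open>maj\<close> itself suffices.\<close>

lemma maj_Hs:
  assumes "s \<le> 0"
  shows "(\<lambda>\<zeta>. of_real (R * maj \<zeta>)) \<in> Hs s"
proof -
  have "integrable lborel maj"
    unfolding maj_def [abs_def] by (rule integrable_tensor [OF integrable_lor integrable_lor])
  then have i: "integrable lborel (\<lambda>\<zeta>. R\<^sup>2 * maj \<zeta>)" by simp
  have "integrable lborel (\<lambda>\<zeta>. jap (fst \<zeta>) powr (2 * s) * (cmod (of_real (R * maj \<zeta>)))\<^sup>2)"
  proof (rule Bochner_Integration.integrable_bound [OF i])
    show "AE \<zeta> in lborel. norm (jap (fst \<zeta>) powr (2 * s) * (cmod (of_real (R * maj \<zeta>)))\<^sup>2) \<le> norm (R\<^sup>2 * maj \<zeta>)"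
    proof (intro always_eventually allI)
      fix \<zeta> :: "real \<times> real"
      have "jap (fst \<zeta>) powr (2 * s) \<le> 1"
        using assms powr_mono [of "2 * s" 0 "jap (fst \<zeta>)"] by (simp add: jap_def split: if_splits)
      moreover have "(maj \<zeta>)\<^sup>2 \<le> maj \<zeta>"
        using maj_pos [of \<zeta>] maj_le_1 [of \<zeta>] by (simp add: power2_eq_square mult_le_cancel_right1)
      ultimately have "jap (fst \<zeta>) powr (2 * s) * (R\<^sup>2 * (maj \<zeta>)\<^sup>2) \<le> 1 * (R\<^sup>2 * maj \<zeta>)"
        by (intro mult_mono mult_left_mono) auto
      then show "norm (jap (fst \<zeta>) powr (2 * s) * (cmod (of_real (R * maj \<zeta>)))\<^sup>2) \<le> norm (R\<^sup>2 * maj \<zeta>)"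
        using maj_pos [of \<zeta>] by (simp add: power_mult_distrib abs_mult norm_mult)
    qed
  qed measurable
  then show ?thesis by (simp add: Hs_def)
qed

section \<open>Picard iteration\<close>

text \<open>Where the product is nonzero both input frequencies are at least N; as they add up to
  less than m + N, both are below m. So the square at \<zeta> depends only on values at frequencies
  below m.\<close>

lemma sqhat_cong:
  assumes "\<And>\<zeta>. fst \<zeta> < m \<Longrightarrow> f \<zeta> = g \<zeta>"
    and "\<And>\<zeta>. fst \<zeta> < N \<Longrightarrow> f \<zeta> = 0" "\<And>\<zeta>. fst \<zeta> < N \<Longrightarrow> g \<zeta> = 0"
    and "fst \<zeta> < m + N"
  shows "sqhat f \<zeta> = sqhat g \<zeta>"
proof -
  have "f (\<zeta> - \<zeta>') * f \<zeta>' = g (\<zeta> - \<zeta>') * g \<zeta>'" for \<zeta>'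
  proof (cases "fst \<zeta>' < N \<or> fst (\<zeta> - \<zeta>') < N")
    case True
    then show ?thesis
      using assms(2,3) [of \<zeta>'] assms(2,3) [of "\<zeta> - \<zeta>'"] by auto
  next
    case False
    with assms(4) have "fst \<zeta>' < m" "fst (\<zeta> - \<zeta>') < m" by auto
    then show ?thesis using assms(1) by simp
  qed
  then show ?thesis by (simp add: sqhat_def)
qed

lemma sqhat_eq_0:
  assumes "\<And>\<zeta>. fst \<zeta> < N \<Longrightarrow> f \<zeta> = 0" "fst \<zeta> < 2 * N"
  shows "sqhat f \<zeta> = 0"
proof -
  have "sqhat f \<zeta> = sqhat (\<lambda>_. 0) \<zeta>"
    by (rule sqhat_cong [where m = N and N = N]) (use assms in auto)
  then show ?thesis by (simp add: sqhat_def)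
qed

text \<open>Joint measurability in time and frequency is the property carried through the iteration,
  since each step integrates over both.\<close>

lemma measurable_sqhat:
  assumes [measurable]: "(\<lambda>p. f (fst p) (snd p)) \<in> borel_measurable (borel \<Otimes>\<^sub>M borel)"
  shows "(\<lambda>p. sqhat (f (fst p)) (snd p)) \<in> borel_measurable (borel \<Otimes>\<^sub>M borel)"
proof -
  have [measurable]: "(\<lambda>q. f (fst (fst q)) (snd (fst q) - snd q)) \<in> borel_measurable ((borel \<Otimes>\<^sub>M borel) \<Otimes>\<^sub>M lborel)"
    by (rule measurable_compose [OF _ assms, of "\<lambda>q. (fst (fst q), snd (fst q) - snd q)", simplified]) measurable
  have [measurable]: "(\<lambda>q. f (fst (fst q)) (snd q)) \<in> borel_measurable ((borel \<Otimes>\<^sub>M borel) \<Otimes>\<^sub>M lborel)"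
    by (rule measurable_compose [OF _ assms, of "\<lambda>q. (fst (fst q), snd q)", simplified]) measurable
  have "(\<lambda>q. f (fst (fst q)) (snd (fst q) - snd q) * f (fst (fst q)) (snd q))
      \<in> borel_measurable ((borel \<Otimes>\<^sub>M borel) \<Otimes>\<^sub>M lborel)"
    by measurable
  then show ?thesis
    unfolding sqhat_def
    by (intro borel_measurable_times borel_measurable_const lborel.borel_measurable_lebesgue_integral)
       (simp add: split_beta)
qed

section \<open>The Duhamel map and its iterates\<close>

definition duhamel :: "real \<Rightarrow> fhat \<Rightarrow> tfhat \<Rightarrow> tfhat" where
  "duhamel \<epsilon> \<phi> f t \<zeta> = Wsym \<epsilon> t \<zeta> * \<phi> \<zeta>
     - set_lebesgue_integral lborel {0..t} (\<lambda>t'. Wsym \<epsilon> (t - t') \<zeta> * Lsym \<zeta> * sqhat (f t') \<zeta>)"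

lemma measurable_duhamel:
  assumes f: "(\<lambda>p. f (fst p) (snd p)) \<in> borel_measurable (borel \<Otimes>\<^sub>M borel)"
    and [measurable]: "\<phi> \<in> borel_measurable borel"
  shows "(\<lambda>p. duhamel \<epsilon> \<phi> f (fst p) (snd p)) \<in> borel_measurable (borel \<Otimes>\<^sub>M borel)"
proof -
  have [measurable]: "(\<lambda>q. sqhat (f (snd q)) (snd (fst q))) \<in> borel_measurable ((borel \<Otimes>\<^sub>M borel) \<Otimes>\<^sub>M lborel)"
    by (rule measurable_compose [OF _ measurable_sqhat [OF f], of "\<lambda>q. (snd q, snd (fst q))", simplified]) measurable
  have [measurable]: "(\<lambda>q. indicator {0..fst (fst q)} (snd q) :: real)
      \<in> borel_measurable ((borel \<Otimes>\<^sub>M (borel :: (real \<times> real) measure)) \<Otimes>\<^sub>M (lborel :: real measure))"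
    unfolding indicator_def of_bool_def atLeastAtMost_iff by measurable
  have "(\<lambda>q. indicator {0..fst (fst q)} (snd q) *\<^sub>R (Wsym \<epsilon> (fst (fst q) - snd q) (snd (fst q)) * Lsym (snd (fst q)) *
      sqhat (f (snd q)) (snd (fst q)))) \<in> borel_measurable ((borel \<Otimes>\<^sub>M borel) \<Otimes>\<^sub>M lborel)"
    by measurable
  then have [measurable]: "(\<lambda>p. set_lebesgue_integral lborel {0..fst p} (\<lambda>t'. Wsym \<epsilon> (fst p - t') (snd p) * Lsym (snd p) * sqhat (f t') (snd p)))
     \<in> borel_measurable (borel \<Otimes>\<^sub>M borel)"
    unfolding set_lebesgue_integral_def
    by (intro lborel.borel_measurable_lebesgue_integral) (simp add: split_beta)
  show ?thesis
    unfolding duhamel_def by measurable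
qed

lemma
  assumes [measurable]: "f \<in> borel_measurable borel"
    and fR: "\<And>\<zeta>. cmod (f \<zeta>) \<le> R * maj \<zeta>"
    and i: "\<And>\<zeta>. integrable lborel (\<lambda>\<zeta>'. maj (\<zeta> - \<zeta>') * maj \<zeta>')"
    and K: "\<And>\<zeta>. (LINT \<zeta>'|lborel. maj (\<zeta> - \<zeta>') * maj \<zeta>') \<le> K * maj \<zeta>"
  shows integrable_conv: "integrable lborel (\<lambda>\<zeta>'. f (\<zeta> - \<zeta>') * f \<zeta>')"
    and norm_sqhat_le: "cmod (sqhat f \<zeta>) \<le> R\<^sup>2 * K * maj \<zeta>"
proof -
  have i': "integrable lborel (\<lambda>\<zeta>'. R\<^sup>2 * (maj (\<zeta> - \<zeta>') * maj \<zeta>'))"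
    using i by simp
  have le: "cmod (f (\<zeta> - \<zeta>') * f \<zeta>') \<le> R\<^sup>2 * (maj (\<zeta> - \<zeta>') * maj \<zeta>')" for \<zeta>'
  proof -
    have "0 \<le> R * maj (\<zeta> - \<zeta>')" by (rule order_trans [OF norm_ge_zero fR])
    then have "cmod (f (\<zeta> - \<zeta>')) * cmod (f \<zeta>') \<le> (R * maj (\<zeta> - \<zeta>')) * (R * maj \<zeta>')"
      by (intro mult_mono fR) auto
    then show ?thesis by (simp add: norm_mult power2_eq_square mult_ac)
  qed
  show ic: "integrable lborel (\<lambda>\<zeta>'. f (\<zeta> - \<zeta>') * f \<zeta>')"
    by (rule Bochner_Integration.integrable_bound [OF i'])
       (use order_trans [OF le abs_ge_self] in auto)
  have "cmod (LINT \<zeta>'|lborel. f (\<zeta> - \<zeta>') * f \<zeta>') \<le> (LINT \<zeta>'|lborel. R\<^sup>2 * (maj (\<zeta> - \<zeta>') * maj \<zeta>'))"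
    by (rule order_trans [OF integral_norm_bound integral_mono]) (use ic i' le in auto)
  also have "\<dots> \<le> R\<^sup>2 * (K * maj \<zeta>)"
    using K [of \<zeta>] by (simp add: mult_left_mono)
  finally have b: "cmod (LINT \<zeta>'|lborel. f (\<zeta> - \<zeta>') * f \<zeta>') \<le> R\<^sup>2 * K * maj \<zeta>" by (simp add: mult_ac)
  \<comment> \<open>The normalisation of the convolution enters the upper bound only as a factor at
    most 1.\<close>
  have "1 * 1 \<le> pi * pi" using pi_ge_two by (intro mult_mono) auto
  then have "1 / (4 * pi ^ 2) \<le> 1" by (simp add: power2_eq_square)
  then have "cmod (sqhat f \<zeta>) \<le> 1 * cmod (LINT \<zeta>'|lborel. f (\<zeta> - \<zeta>') * f \<zeta>')"
    unfolding sqhat_def norm_mult by (intro mult_right_mono) (auto simp: norm_divide norm_mult norm_power)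
  with b show "cmod (sqhat f \<zeta>) \<le> R\<^sup>2 * K * maj \<zeta>" by simp
qed

text \<open>Starting from 0 makes the iterates n and n + 1 agree for \<xi> < (n + 1) N; the case n =
  0 is the support condition on the datum.\<close>

primrec picard :: "real \<Rightarrow> fhat \<Rightarrow> nat \<Rightarrow> tfhat" where
  "picard \<epsilon> \<phi> 0 = (\<lambda>t \<zeta>. 0)"
| "picard \<epsilon> \<phi> (Suc n) = duhamel \<epsilon> \<phi> (picard \<epsilon> \<phi> n)"

lemma duhamel_eq_0:
  assumes "\<And>t \<zeta>. fst \<zeta> < N \<Longrightarrow> f t \<zeta> = 0" "\<And>\<zeta>. fst \<zeta> < N \<Longrightarrow> \<phi> \<zeta> = 0" "N \<ge> 0" "fst \<zeta> < N"
  shows "duhamel \<epsilon> \<phi> f t \<zeta> = 0"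
proof -
  have "sqhat (f t') \<zeta> = 0" for t'
    by (rule sqhat_eq_0 [of N]) (use assms in auto)
  then show ?thesis using assms by (simp add: duhamel_def set_lebesgue_integral_def)
qed

lemma picard_eq_0:
  assumes "\<And>\<zeta>. fst \<zeta> < N \<Longrightarrow> \<phi> \<zeta> = 0" "N \<ge> 0" "fst \<zeta> < N"
  shows "picard \<epsilon> \<phi> n t \<zeta> = 0"
  using assms(3) by (induction n arbitrary: t \<zeta>) (auto intro: duhamel_eq_0 [of N] assms(1,2))

text \<open>Frequencies in the first variable add up under convolution, so each Picard step
  only alters frequencies \<open>\<xi> \<ge> (n + 1) N\<close> and the iteration converges trivially.\<close>
lemma picard_stable:
  assumes "\<And>\<zeta>. fst \<zeta> < N \<Longrightarrow> \<phi> \<zeta> = 0" "N \<ge> 0" "fst \<zeta> < real (Suc n) * N"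
  shows "picard \<epsilon> \<phi> (Suc n) t \<zeta> = picard \<epsilon> \<phi> n t \<zeta>"
  using assms(3)
proof (induction n arbitrary: t \<zeta>)
  case 0
  then show ?case using picard_eq_0 [of N \<phi> \<zeta> \<epsilon> 1 t, OF assms(1)] assms(2) by simp
next
  case (Suc n)
  \<comment> \<open>Agreement below (n + 1) N passes to the squares below (n + 2) N.\<close>
  have "sqhat (picard \<epsilon> \<phi> (Suc n) t') \<zeta> = sqhat (picard \<epsilon> \<phi> n t') \<zeta>" for t'
    by (rule sqhat_cong [where m = "real (Suc n) * N" and N = N])
       (use Suc picard_eq_0 [of N \<phi> _ \<epsilon> _ t', OF assms(1)] assms(2) in \<open>auto simp: algebra_simps simp del: picard.simps\<close>)
  then show ?case
    by (subst (1 2) picard.simps(2)) (simp add: duhamel_def del: picard.simps)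
qed

lemma picard_eq:
  assumes "\<And>\<zeta>. fst \<zeta> < N \<Longrightarrow> \<phi> \<zeta> = 0" "N \<ge> 0" "fst \<zeta> < real (Suc n) * N" "n \<le> m"
  shows "picard \<epsilon> \<phi> m t \<zeta> = picard \<epsilon> \<phi> n t \<zeta>"
  using assms(4)
proof (induction m rule: dec_induct)
  case (step m)
  have "real (Suc n) * N \<le> real (Suc m) * N"
    using step assms(2) by (intro mult_right_mono) auto
  then show ?case
    using picard_stable [of N \<phi> \<zeta> m \<epsilon> t, OF assms(1,2)] step assms(3) by simp
qed simp

text \<open>Parabolic smoothing: the factor 2 \<xi>^2 from \<Lambda> is paid for by the time
  integral of the damping, at most 1/\<open>rho\<close> \<le> 1/(3 \<xi>^2). The two derivatives
  thus cost nothing, and the bound \<open>M\<close> on the square survives unchanged.\<close>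

lemma
  assumes f: "(\<lambda>p. f (fst p) (snd p)) \<in> borel_measurable (borel \<Otimes>\<^sub>M borel)"
    and b: "\<And>t'. t' \<in> {0..t} \<Longrightarrow> cmod (sqhat (f t') \<zeta>) \<le> M"
    and \<zeta>: "fst \<zeta> \<ge> 2" and t: "t \<ge> 0"
  shows set_integrable_duhamel: "set_integrable lborel {0..t} (\<lambda>t'. Wsym \<epsilon> (t - t') \<zeta> * Lsym \<zeta> * sqhat (f t') \<zeta>)" (is ?A)
    and norm_integral_duhamel_le:
      "cmod (set_lebesgue_integral lborel {0..t} (\<lambda>t'. Wsym \<epsilon> (t - t') \<zeta> * Lsym \<zeta> * sqhat (f t') \<zeta>)) \<le> M" (is ?B)
proof -
  let ?r = "rho (fst \<zeta>)"
  have r: "?r > 0" "2 * (fst \<zeta>)\<^sup>2 / ?r \<le> 1"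
  proof -
    have "0 < (fst \<zeta>)\<^sup>2" using \<zeta> by simp
    with rho_ge [OF \<zeta>] show r: "?r > 0" by linarith
    show "2 * (fst \<zeta>)\<^sup>2 / ?r \<le> 1"
      using rho_ge [OF \<zeta>] zero_le_power2 [of "fst \<zeta>"] unfolding pos_divide_le_eq [OF r] by linarith
  qed
  have M: "M \<ge> 0" using order_trans [OF norm_ge_zero b [of 0]] t by simp
  have [measurable]: "(\<lambda>t'. sqhat (f t') \<zeta>) \<in> borel_measurable borel"
    by (rule measurable_compose [OF _ measurable_sqhat [OF f], of "\<lambda>t'. (t', \<zeta>)", simplified]) measurable
  have le: "cmod (Wsym \<epsilon> (t - t') \<zeta> * Lsym \<zeta> * sqhat (f t') \<zeta>) \<le> 2 * (fst \<zeta>)\<^sup>2 * M * exp (- (t - t') * ?r)"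
    if "t' \<in> {0..t}" for t'
  proof -
    have "cmod (Lsym \<zeta>) * cmod (sqhat (f t') \<zeta>) \<le> (2 * (fst \<zeta>)\<^sup>2) * M"
      by (intro mult_mono norm_Lsym_le \<zeta> b that) auto
    then have "exp (- (t - t') * ?r) * (cmod (Lsym \<zeta>) * cmod (sqhat (f t') \<zeta>)) \<le> exp (- (t - t') * ?r) * ((2 * (fst \<zeta>)\<^sup>2) * M)"
      by (intro mult_left_mono) auto
    then show ?thesis by (simp add: norm_mult norm_Wsym mult_ac)
  qed
  have i: "set_integrable lborel {0..t} (\<lambda>t'. 2 * (fst \<zeta>)\<^sup>2 * M * exp (- (t - t') * ?r))"
    by (rule set_integrable_mult_right) (rule set_integrable_exp [OF r(1) t])
  have le': "norm (indicator {0..t} t' *\<^sub>R (Wsym \<epsilon> (t - t') \<zeta> * Lsym \<zeta> * sqhat (f t') \<zeta>))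
      \<le> indicator {0..t} t' *\<^sub>R (2 * (fst \<zeta>)\<^sup>2 * M * exp (- (t - t') * ?r))" for t'
    using le [of t'] by (cases "t' \<in> {0..t}") (simp_all del: norm_mult)
  show A: ?A
    unfolding set_integrable_def
    by (rule Bochner_Integration.integrable_bound [OF i [unfolded set_integrable_def]])
       (simp, intro always_eventually allI order_trans [OF le'], simp)
  have "cmod (set_lebesgue_integral lborel {0..t} (\<lambda>t'. Wsym \<epsilon> (t - t') \<zeta> * Lsym \<zeta> * sqhat (f t') \<zeta>))
      \<le> (LINT t':{0..t}|lborel. 2 * (fst \<zeta>)\<^sup>2 * M * exp (- (t - t') * ?r))"
    unfolding set_lebesgue_integral_def
    by (rule order_trans [OF integral_norm_bound integral_mono [OF _ _ le']])
       (rule integrable_norm A [unfolded set_integrable_def] i [unfolded set_integrable_def])+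
  also have "\<dots> = 2 * (fst \<zeta>)\<^sup>2 * M * (LINT t':{0..t}|lborel. exp (- (t - t') * ?r))"
    by (rule set_integral_mult_right)
  also have "\<dots> \<le> 2 * (fst \<zeta>)\<^sup>2 * M * (1 / ?r)"
    by (intro mult_left_mono set_integral_exp_le r t) (use M in auto)
  also have "\<dots> = (2 * (fst \<zeta>)\<^sup>2 / ?r) * M" by simp
  also have "\<dots> \<le> 1 * M" by (intro mult_right_mono r M)
  finally show ?B by simp
qed

lemma measurable_section:
  assumes "(\<lambda>p. f (fst p) (snd p)) \<in> borel_measurable (borel \<Otimes>\<^sub>M borel)"
  shows "f t \<in> borel_measurable borel"
  by (rule measurable_compose [OF _ assms, of "\<lambda>\<zeta>. (t, \<zeta>)", simplified]) measurable

text \<open>The Duhamel map preserves the set of functions below R \<open>maj\<close>: half of R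
  goes to the free evolution, and R^2 K \<le> R/2 to the nonlinear term.\<close>

lemma norm_duhamel_le:
  assumes f: "(\<lambda>p. f (fst p) (snd p)) \<in> borel_measurable (borel \<Otimes>\<^sub>M borel)"
    and f0: "\<And>t \<zeta>. fst \<zeta> < N \<Longrightarrow> f t \<zeta> = 0" and \<phi>0: "\<And>\<zeta>. fst \<zeta> < N \<Longrightarrow> \<phi> \<zeta> = 0"
    and N: "N \<ge> 2" and R: "R \<ge> 0" and RK: "R * K \<le> 1 / 2"
    and fR: "\<And>t \<zeta>. t \<ge> 0 \<Longrightarrow> cmod (f t \<zeta>) \<le> R * maj \<zeta>"
    and \<phi>R: "\<And>\<zeta>. cmod (\<phi> \<zeta>) \<le> R / 2 * maj \<zeta>"
    and i: "\<And>\<zeta>. integrable lborel (\<lambda>\<zeta>'. maj (\<zeta> - \<zeta>') * maj \<zeta>')"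
    and K: "\<And>\<zeta>. (LINT \<zeta>'|lborel. maj (\<zeta> - \<zeta>') * maj \<zeta>') \<le> K * maj \<zeta>"
    and t: "t \<ge> 0"
  shows "cmod (duhamel \<epsilon> \<phi> f t \<zeta>) \<le> R * maj \<zeta>"
proof (cases "fst \<zeta> < N")
  case True
  then show ?thesis
    using duhamel_eq_0 [of N f \<phi> \<zeta> \<epsilon> t] f0 \<phi>0 N R maj_pos [of \<zeta>] by simp
next
  case False
  with N have \<zeta>: "fst \<zeta> \<ge> 2" by simp
  have "cmod (Wsym \<epsilon> t \<zeta>) * cmod (\<phi> \<zeta>) \<le> 1 * (R / 2 * maj \<zeta>)"
    by (intro mult_mono norm_Wsym_le_1 \<zeta> t \<phi>R) auto
  moreover have "cmod (set_lebesgue_integral lborel {0..t} (\<lambda>t'. Wsym \<epsilon> (t - t') \<zeta> * Lsym \<zeta> * sqhat (f t') \<zeta>))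
      \<le> R\<^sup>2 * K * maj \<zeta>"
    by (rule norm_integral_duhamel_le [OF f _ \<zeta> t])
       (use norm_sqhat_le [OF measurable_section [OF f] fR i K] in auto)
  moreover have "R * (R * K) * maj \<zeta> \<le> R * (1 / 2) * maj \<zeta>"
    using R RK maj_pos [of \<zeta>] by (intro mult_right_mono mult_left_mono) auto
  moreover have "cmod (duhamel \<epsilon> \<phi> f t \<zeta>) \<le> cmod (Wsym \<epsilon> t \<zeta> * \<phi> \<zeta>) +
      cmod (set_lebesgue_integral lborel {0..t} (\<lambda>t'. Wsym \<epsilon> (t - t') \<zeta> * Lsym \<zeta> * sqhat (f t') \<zeta>))"
    unfolding duhamel_def by (rule norm_triangle_ineq4)
  ultimately show ?thesis
    by (simp add: norm_mult power2_eq_square mult_ac)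
qed

text \<open>Writing W(t - t') = W(t) W(-t') leaves t only in a continuous factor and in the upper
  limit of an integral. W(-t') is not bounded over all frequencies, but here \<zeta> is
  fixed.\<close>

lemma continuous_on_duhamel:
  assumes f: "(\<lambda>p. f (fst p) (snd p)) \<in> borel_measurable (borel \<Otimes>\<^sub>M borel)"
    and M: "\<And>t. t \<in> {0..T} \<Longrightarrow> cmod (sqhat (f t) \<zeta>) \<le> M"
  shows "continuous_on {0..T} (\<lambda>t. duhamel \<epsilon> \<phi> f t \<zeta>)"
proof -
  define q where "q = (\<lambda>t'. Wsym \<epsilon> (- t') \<zeta> * Lsym \<zeta> * sqhat (f t') \<zeta>)"
  have [measurable]: "(\<lambda>t'. sqhat (f t') \<zeta>) \<in> borel_measurable borel"
    by (rule measurable_compose [OF _ measurable_sqhat [OF f], of "\<lambda>t'. (t', \<zeta>)", simplified]) measurable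
  have q [measurable]: "q \<in> borel_measurable borel"
    unfolding q_def by measurable
  have "cmod (q t') \<le> exp (T * \<bar>rho (fst \<zeta>)\<bar>) * cmod (Lsym \<zeta>) * M" if t': "t' \<in> {0..T}" for t'
  proof -
    have "t' * rho (fst \<zeta>) \<le> t' * \<bar>rho (fst \<zeta>)\<bar>"
      using t' by (intro mult_left_mono) auto
    also have "\<dots> \<le> T * \<bar>rho (fst \<zeta>)\<bar>"
      using t' by (intro mult_right_mono) auto
    finally have "t' * rho (fst \<zeta>) \<le> T * \<bar>rho (fst \<zeta>)\<bar>" .
    then show ?thesis
      unfolding q_def norm_mult norm_Wsym
      by (intro mult_mono M t') (use t' order_trans [OF norm_ge_zero M] in auto)
  qed
  then have i: "set_integrable lborel {0..T} q"
    by (rule set_integrable_bounded [OF q])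
  have eq: "duhamel \<epsilon> \<phi> f t \<zeta> = Wsym \<epsilon> t \<zeta> * (\<phi> \<zeta> - integral {0..t} q)" if "t \<in> {0..T}" for t
  proof -
    have it: "set_integrable lborel {0..t} q"
      by (rule set_integrable_subset [OF i]) (use that in auto)
    have "Wsym \<epsilon> (t - t') \<zeta> * Lsym \<zeta> * sqhat (f t') \<zeta> = Wsym \<epsilon> t \<zeta> * q t'" for t'
      using Wsym_add [of \<epsilon> t "- t'" \<zeta>] by (simp add: q_def mult_ac)
    then have "duhamel \<epsilon> \<phi> f t \<zeta> = Wsym \<epsilon> t \<zeta> * \<phi> \<zeta> - Wsym \<epsilon> t \<zeta> * (LINT t':{0..t}|lborel. q t')"
      unfolding duhamel_def by (simp add: set_integral_mult_right)
    then show ?thesis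
      by (simp add: set_borel_integral_eq_integral(2) [OF it] right_diff_distrib)
  qed
  have "continuous_on {0..T} (\<lambda>t. Wsym \<epsilon> t \<zeta> * (\<phi> \<zeta> - integral {0..t} q))"
    unfolding Wsym_def
    by (intro continuous_intros indefinite_integral_continuous_1 set_borel_integral_eq_integral(1) i)
  then show ?thesis
    using eq by (subst continuous_on_cong [OF refl eq]) auto
qed

text \<open>Dominated convergence along sequences of times upgrades continuity at each frequency to
  continuity in the norm, with majorant 4 \<bar>g\<bar>^2 times the weight.\<close>

lemma CTH_dominated:
  assumes m: "\<And>t. t \<in> {0..T} \<Longrightarrow> v t \<in> borel_measurable borel"
    and g: "g \<in> Hs s" "\<And>t \<zeta>. t \<in> {0..T} \<Longrightarrow> cmod (v t \<zeta>) \<le> cmod (g \<zeta>)"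
    and c: "\<And>\<zeta>. continuous_on {0..T} (\<lambda>t. v t \<zeta>)"
  shows "v \<in> CTH s T"
proof -
  let ?w = "\<lambda>\<zeta>::real \<times> real. jap (fst \<zeta>) powr (2 * s)"
  have H: "v t \<in> Hs s" if "t \<in> {0..T}" for t
    by (rule Hs_dominated [OF g(1) m]) (use that g(2) in auto)
  have "((\<lambda>t'. hnorm s (\<lambda>\<zeta>. v t' \<zeta> - v t \<zeta>)) \<longlongrightarrow> 0) (at t within {0..T})" if t: "t \<in> {0..T}" for t
    unfolding tendsto_at_iff_sequentially
  proof (intro allI impI)
    fix X assume X: "\<forall>i. X i \<in> {0..T} - {t}" "X \<longlonglongrightarrow> t"
    have Xi: "X i \<in> {0..T}" for i using X(1) by auto
    have gi: "integrable lborel (\<lambda>\<zeta>. 4 * (?w \<zeta> * (cmod (g \<zeta>))\<^sup>2))"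
      using HsD(2) [OF g(1)] by simp
    have "(\<lambda>i. LINT \<zeta>|lborel. ?w \<zeta> * (cmod (v (X i) \<zeta> - v t \<zeta>))\<^sup>2) \<longlonglongrightarrow> (LINT \<zeta>|(lborel :: (real \<times> real) measure). 0)"
    proof (rule integral_dominated_convergence [OF _ _ gi])
      show "(\<lambda>\<zeta>. ?w \<zeta> * (cmod (v (X i) \<zeta> - v t \<zeta>))\<^sup>2) \<in> borel_measurable lborel" for i
        using HsD(2) [OF Hs_diff [OF H [OF Xi] H [OF t]]] by (rule borel_measurable_integrable)
      show "AE \<zeta> in lborel. (\<lambda>i. ?w \<zeta> * (cmod (v (X i) \<zeta> - v t \<zeta>))\<^sup>2) \<longlonglongrightarrow> 0"
      proof (intro always_eventually allI)
        fix \<zeta>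
        have "(\<lambda>i. v (X i) \<zeta>) \<longlonglongrightarrow> v t \<zeta>"
          by (rule continuous_on_tendsto_compose [OF c X(2) t]) (use Xi in auto)
        then have "(\<lambda>i. ?w \<zeta> * (cmod (v (X i) \<zeta> - v t \<zeta>))\<^sup>2) \<longlonglongrightarrow> ?w \<zeta> * (cmod (v t \<zeta> - v t \<zeta>))\<^sup>2"
          by (intro tendsto_intros)
        then show "(\<lambda>i. ?w \<zeta> * (cmod (v (X i) \<zeta> - v t \<zeta>))\<^sup>2) \<longlonglongrightarrow> 0" by simp
      qed
      show "AE \<zeta> in lborel. norm (?w \<zeta> * (cmod (v (X i) \<zeta> - v t \<zeta>))\<^sup>2) \<le> 4 * (?w \<zeta> * (cmod (g \<zeta>))\<^sup>2)" for i
      proof (intro always_eventually allI)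
        fix \<zeta>
        have "(cmod (v (X i) \<zeta> - v t \<zeta>))\<^sup>2 \<le> (cmod (g \<zeta>) + cmod (g \<zeta>))\<^sup>2"
          by (intro power_mono order_trans [OF norm_triangle_ineq4 add_mono] g(2) Xi t norm_ge_zero)
        also have "\<dots> = 4 * (cmod (g \<zeta>))\<^sup>2" by (simp add: power2_eq_square)
        finally have "?w \<zeta> * (cmod (v (X i) \<zeta> - v t \<zeta>))\<^sup>2 \<le> ?w \<zeta> * (4 * (cmod (g \<zeta>))\<^sup>2)"
          by (rule mult_left_mono) simp
        then show "norm (?w \<zeta> * (cmod (v (X i) \<zeta> - v t \<zeta>))\<^sup>2) \<le> 4 * (?w \<zeta> * (cmod (g \<zeta>))\<^sup>2)"
          by simp
      qed
    qed simp
    then have "(\<lambda>i. hnorm s (\<lambda>\<zeta>. v (X i) \<zeta> - v t \<zeta>)) \<longlonglongrightarrow> sqrt 0"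
      unfolding hnorm_def by (intro tendsto_real_sqrt) simp
    then show "((\<lambda>t'. hnorm s (\<lambda>\<zeta>. v t' \<zeta> - v t \<zeta>)) \<circ> X) \<longlonglongrightarrow> 0"
      by (simp add: o_def)
  qed
  with H show ?thesis by (simp add: CTH_def)
qed

text \<open>Smallness is measured against \<open>maj\<close> and not in H^s; this suffices, since
  only small multiples of one fixed datum will be inserted. The last conclusion is the exact
  expansion to second order.\<close>

lemma small_data_solution:
  assumes \<phi> [measurable]: "\<phi> \<in> borel_measurable borel" and \<phi>0: "\<And>\<zeta>. fst \<zeta> < N \<Longrightarrow> \<phi> \<zeta> = 0"
    and N: "N \<ge> 2" and R: "R \<ge> 0" and RK: "R * K \<le> 1 / 2"
    and \<phi>R: "\<And>\<zeta>. cmod (\<phi> \<zeta>) \<le> R / 2 * maj \<zeta>"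
    and i: "\<And>\<zeta>. integrable lborel (\<lambda>\<zeta>'. maj (\<zeta> - \<zeta>') * maj \<zeta>')"
    and K: "\<And>\<zeta>. (LINT \<zeta>'|lborel. maj (\<zeta> - \<zeta>') * maj \<zeta>') \<le> K * maj \<zeta>"
    and s: "s \<le> 0"
  obtains v where "v \<in> CTH s T" "is_solution \<epsilon> T \<phi> v"
    "\<And>t \<zeta>. fst \<zeta> < 3 * N \<Longrightarrow> v t \<zeta> = duhamel \<epsilon> \<phi> (\<lambda>t' \<zeta>. Wsym \<epsilon> t' \<zeta> * \<phi> \<zeta>) t \<zeta>"
proof -
  let ?p = "picard \<epsilon> \<phi>"
  have N0: "N \<ge> 0" using N by simp
  have pm: "(\<lambda>p. ?p n (fst p) (snd p)) \<in> borel_measurable (borel \<Otimes>\<^sub>M borel)" for n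
    by (induction n) (auto intro: measurable_duhamel)
  have p0: "fst \<zeta> < N \<Longrightarrow> ?p n t \<zeta> = 0" for n t \<zeta>
    by (rule picard_eq_0 [of N]) (use \<phi>0 N0 in auto)
  have pR: "cmod (?p n t \<zeta>) \<le> R * maj \<zeta>" if "t \<ge> 0" for n t \<zeta>
    using that
  proof (induction n arbitrary: t \<zeta>)
    case (Suc n)
    then show ?case
      using norm_duhamel_le [OF pm p0 \<phi>0 N R RK _ \<phi>R i K] by simp
  qed (use R maj_pos in \<open>auto simp: less_imp_le\<close>)
  \<comment> \<open>The limit is written down directly: at \<zeta> the iterates are constant from
    index \<open>k \<zeta>\<close> on, because N \<ge> 1. Negative frequencies get index 0, that is
    the value 0.\<close>
  define k where "k = (\<lambda>\<zeta>::real \<times> real. nat \<lceil>fst \<zeta>\<rceil>)"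
  define v where "v = (\<lambda>t \<zeta>. ?p (k \<zeta>) t \<zeta>)"
  have k: "fst \<zeta> < real (Suc (k \<zeta>)) * N" for \<zeta>
  proof -
    have "fst \<zeta> < real (Suc (k \<zeta>)) * 1" by (simp add: k_def) linarith
    also have "\<dots> \<le> real (Suc (k \<zeta>)) * N" using N by (intro mult_left_mono) auto
    finally show ?thesis .
  qed
  have vp: "v t \<zeta> = ?p n t \<zeta>" if "fst \<zeta> < real (Suc n) * N" for n t \<zeta>
    using picard_eq [of N \<phi> \<zeta> n "k \<zeta>", OF \<phi>0 N0 that] picard_eq [of N \<phi> \<zeta> "k \<zeta>" n, OF \<phi>0 N0 k]
    unfolding v_def by (metis nle_le)
  have v0: "fst \<zeta> < N \<Longrightarrow> v t \<zeta> = 0" for t \<zeta>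
    by (simp add: v_def p0)
  have vR: "t \<ge> 0 \<Longrightarrow> cmod (v t \<zeta>) \<le> R * maj \<zeta>" for t \<zeta>
    by (simp add: v_def pR)
  \<comment> \<open>\<open>k\<close> takes countably many values, so \<open>v\<close> is glued from
    countably many measurable iterates.\<close>
  have vm: "(\<lambda>p. v (fst p) (snd p)) \<in> borel_measurable (borel \<Otimes>\<^sub>M borel)"
    unfolding v_def
    by (rule measurable_compose_countable [OF pm, of "\<lambda>p. k (snd p)"]) (simp add: k_def)
  have vd: "v t \<zeta> = duhamel \<epsilon> \<phi> v t \<zeta>" for t \<zeta>
  proof -
    have "real (Suc (k \<zeta>)) * N \<le> real (Suc (Suc (k \<zeta>))) * N"
      using N0 by (intro mult_right_mono) auto
    with k have "v t \<zeta> = ?p (Suc (k \<zeta>)) t \<zeta>" by (intro vp) (rule order.strict_trans2)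
    also have "\<dots> = duhamel \<epsilon> \<phi> (?p (k \<zeta>)) t \<zeta>" by simp
    also have "\<dots> = duhamel \<epsilon> \<phi> v t \<zeta>"
    proof -
      have "sqhat (?p (k \<zeta>) t') \<zeta> = sqhat (v t') \<zeta>" for t'
        by (rule sqhat_cong [where m = "real (Suc (k \<zeta>)) * N" and N = N])
           (use vp p0 v0 k [of \<zeta>] N in auto)
      then show ?thesis by (simp add: duhamel_def)
    qed
    finally show ?thesis .
  qed
  have sq: "t \<ge> 0 \<Longrightarrow> cmod (sqhat (v t) \<zeta>) \<le> R\<^sup>2 * K * maj \<zeta>" for t \<zeta>
    by (rule norm_sqhat_le [OF measurable_section [OF vm] vR i K])
  show ?thesis
  proof (rule that)
    show "v \<in> CTH s T"
    proof (rule CTH_dominated [OF measurable_section [OF vm] maj_Hs [OF s, of R]])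
      show "cmod (v t \<zeta>) \<le> cmod (of_real (R * maj \<zeta>))" if "t \<in> {0..T}" for t \<zeta>
        using vR [of t \<zeta>] that R maj_pos [of \<zeta>] by (simp add: norm_mult)
      have "continuous_on {0..T} (\<lambda>t. duhamel \<epsilon> \<phi> v t \<zeta>)" for \<zeta>
        by (rule continuous_on_duhamel [OF vm sq]) auto
      then show "continuous_on {0..T} (\<lambda>t. v t \<zeta>)" for \<zeta>
        by (simp only: vd [symmetric])
    qed
    show "is_solution \<epsilon> T \<phi> v"
      unfolding is_solution_def
    proof (intro ballI always_eventually allI conjI impI)
      fix t \<zeta> assume t: "t \<in> {0..T}"
      show "integrable lborel (\<lambda>\<zeta>'. v t' (\<zeta> - \<zeta>') * v t' \<zeta>')" if "t' \<in> {0..t}" for t'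
        by (rule integrable_conv [OF measurable_section [OF vm] vR i K]) (use that in auto)
      show "set_integrable lborel {0..t} (\<lambda>t'. Wsym \<epsilon> (t - t') \<zeta> * Lsym \<zeta> * sqhat (v t') \<zeta>)"
      proof (cases "fst \<zeta> < N")
        case True
        have "sqhat (v t') \<zeta> = 0" for t'
          by (rule sqhat_eq_0 [of N]) (use v0 True N in auto)
        then show ?thesis by (simp add: set_integrable_def)
      next
        case False
        show ?thesis
          by (rule set_integrable_duhamel [OF vm sq]) (use False N t in auto)
      qed
      show "v t \<zeta> = Wsym \<epsilon> t \<zeta> * \<phi> \<zeta>
         - set_lebesgue_integral lborel {0..t} (\<lambda>t'. Wsym \<epsilon> (t - t') \<zeta> * Lsym \<zeta> * sqhat (v t') \<zeta>)"
        by (subst vd) (simp add: duhamel_def)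
    qed
    fix t and \<zeta> :: "real \<times> real" assume \<zeta>: "fst \<zeta> < 3 * N"
    \<comment> \<open>Below 2 N the square vanishes and \<open>v\<close> is the free evolution;
      below 3 N the square sees \<open>v\<close> only below 2 N.\<close>
    have low: "v t' \<zeta>' = Wsym \<epsilon> t' \<zeta>' * \<phi> \<zeta>'" if "fst \<zeta>' < 2 * N" for t' \<zeta>'
    proof -
      have "sqhat (v t'') \<zeta>' = 0" for t''
        by (rule sqhat_eq_0 [of N]) (use v0 that in auto)
      then show ?thesis by (subst vd) (simp add: duhamel_def set_lebesgue_integral_def)
    qed
    have "sqhat (v t') \<zeta> = sqhat (\<lambda>\<zeta>. Wsym \<epsilon> t' \<zeta> * \<phi> \<zeta>) \<zeta>" for t'
      by (rule sqhat_cong [where m = "2 * N" and N = N]) (use low v0 \<phi>0 \<zeta> in auto)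
    then show "v t \<zeta> = duhamel \<epsilon> \<phi> (\<lambda>t' \<zeta>. Wsym \<epsilon> t' \<zeta> * \<phi> \<zeta>) t \<zeta>"
      by (subst vd) (simp add: duhamel_def)
  qed
qed

section \<open>The high-frequency datum\<close>

definition dbox :: "real \<Rightarrow> (real \<times> real) set" where
  "dbox N = {N..2 * N} \<times> {0..N\<^sup>2}"

text \<open>The sides satisfy 2 N < 5 N/2 and 11 N/4 < 3 N, strictly between the datum and the cubic
  terms. From each of its points one can subtract any point of [N, 3 N/2] \<times> [0, N^2/2] and
  land in \<open>dbox N\<close>.\<close>

definition ebox :: "real \<Rightarrow> (real \<times> real) set" where
  "ebox N = {5 * N / 2..11 * N / 4} \<times> {N\<^sup>2 / 2..N\<^sup>2}"

definition datum :: "real \<Rightarrow> fhat" where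
  "datum N \<zeta> = indicator (dbox N) \<zeta>"

lemma box_borel [measurable]: "{a..b} \<times> {c..d} \<in> sets (borel :: (real \<times> real) measure)"
  by (simp add: borel_prod [symmetric])

lemma
  assumes "a \<le> b" "c \<le> d"
  shows integrable_indicator_box: "integrable lborel (indicator ({a..b} \<times> {c..d}) :: real \<times> real \<Rightarrow> real)"
    and integral_indicator_box: "(LINT \<zeta>|lborel. indicator ({a..b} \<times> {c..d}) \<zeta>) = (b - a) * (d - c)"
proof -
  have eq: "indicator ({a..b} \<times> {c..d}) = (\<lambda>\<zeta>. indicator {a..b} (fst \<zeta>) * indicator {c..d} (snd \<zeta>) :: real)"
    by (auto simp: indicator_def)
  have i: "integrable lborel (indicator {x..y} :: real \<Rightarrow> real)" for x y :: real
    by (intro integrable_real_indicator) (auto simp: emeasure_lborel_Icc_eq)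
  show "integrable lborel (indicator ({a..b} \<times> {c..d}) :: real \<times> real \<Rightarrow> real)"
    unfolding eq by (rule integrable_tensor [OF i i])
  show "(LINT \<zeta>|lborel. indicator ({a..b} \<times> {c..d}) \<zeta>) = (b - a) * (d - c)"
    unfolding eq integral_tensor [OF i i] using assms by simp
qed

lemma measurable_datum [measurable]: "datum N \<in> borel_measurable borel"
  unfolding datum_def [abs_def] dbox_def by measurable

lemma datum_eq_0: "fst \<zeta> < N \<Longrightarrow> datum N \<zeta> = 0"
  by (auto simp: datum_def dbox_def indicator_def)

text \<open>On the box \<open>maj\<close> is at least its value at the corner (2 N, N^2). The
  constant depends badly on N, which only shrinks the range of admissible amplitudes
  \<delta>.\<close>

lemma datum_le_maj:
  obtains m where "m > 0" "\<And>\<zeta>. cmod (datum N \<zeta>) \<le> m * maj \<zeta>"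
proof (rule that)
  let ?m = "lor (2 * N) * lor (N\<^sup>2)"
  have m: "?m > 0" by (intro mult_pos_pos lor_pos)
  then show "1 / ?m > 0" by simp
  show "cmod (datum N \<zeta>) \<le> 1 / ?m * maj \<zeta>" for \<zeta>
  proof (cases "\<zeta> \<in> dbox N")
    case True
    have "lor y \<le> lor x" if "\<bar>x\<bar> \<le> \<bar>y\<bar>" for x y
      using that unfolding lor_def abs_le_square_iff
      by (intro le_imp_inverse_le) (auto simp: add_pos_nonneg)
    with True have "?m \<le> maj \<zeta>"
      unfolding maj_def by (intro mult_mono) (auto simp: dbox_def lor_pos less_imp_le)
    then show ?thesis using m True by (simp add: datum_def field_simps)
  qed (use m maj_pos [of \<zeta>] in \<open>auto simp: datum_def less_imp_le\<close>)
qed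

lemma datum_Hs: "s \<le> 0 \<Longrightarrow> datum N \<in> Hs s"
proof -
  assume s: "s \<le> 0"
  obtain m where m: "m > 0" "\<And>\<zeta>. cmod (datum N \<zeta>) \<le> m * maj \<zeta>"
    by (rule datum_le_maj [of N]) blast
  then show ?thesis
    using maj_pos by (intro Hs_dominated [OF maj_Hs [OF s, of m]] always_eventually) (auto simp: norm_mult less_imp_le)
qed

lemma hnorm_datum_le:
  assumes "N \<ge> 1" "s \<le> 0"
  shows "(hnorm s (datum N))\<^sup>2 \<le> N powr (2 * s) * N ^ 3"
proof -
  have "(hnorm s (datum N))\<^sup>2 \<le> (LINT \<zeta>|lborel. N powr (2 * s) * indicator (dbox N) \<zeta>)"
    unfolding hnorm_power2
  proof (rule integral_mono [OF HsD(2) [OF datum_Hs [OF assms(2)]]])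
    show "integrable lborel (\<lambda>\<zeta>. N powr (2 * s) * indicator (dbox N) \<zeta>)"
      unfolding dbox_def using assms by (intro integrable_mult_right integrable_indicator_box) auto
    show "jap (fst \<zeta>) powr (2 * s) * (cmod (datum N \<zeta>))\<^sup>2 \<le> N powr (2 * s) * indicator (dbox N) \<zeta>" for \<zeta>
    proof (cases "\<zeta> \<in> dbox N")
      case True
      then have "N \<le> jap (fst \<zeta>)" by (auto simp: dbox_def jap_def)
      with assms True show ?thesis by (simp add: datum_def powr_mono2')
    qed (simp add: datum_def)
  qed
  also have "\<dots> = N powr (2 * s) * N ^ 3"
    unfolding dbox_def using assms
    by (subst integral_mult_right_zero, subst integral_indicator_box)
       (auto simp: power3_eq_cube power2_eq_square)
  finally show ?thesis .
qed

section \<open>Lower bound for the second Picard iterate\<close>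

lemma sqhat_scale: "sqhat (\<lambda>\<zeta>. c * f \<zeta>) \<zeta> = c\<^sup>2 * sqhat f \<zeta>"
proof -
  have "(\<lambda>\<zeta>'. (c * f (\<zeta> - \<zeta>')) * (c * f \<zeta>')) = (\<lambda>\<zeta>'. c\<^sup>2 * (f (\<zeta> - \<zeta>') * f \<zeta>'))"
    by (simp add: power2_eq_square mult_ac)
  then show ?thesis by (simp add: sqhat_def)
qed

text \<open>Minus the coefficient of \<delta>^2 in the solution with initial value \<delta>
  \<open>datum N\<close>, on the frequencies where the quadratic formula holds.\<close>

definition second_iterate :: "real \<Rightarrow> real \<Rightarrow> real \<Rightarrow> fhat" where
  "second_iterate \<epsilon> N t \<zeta> = set_lebesgue_integral lborel {0..t}
     (\<lambda>t'. Wsym \<epsilon> (t - t') \<zeta> * Lsym \<zeta> * sqhat (\<lambda>\<zeta>. Wsym \<epsilon> t' \<zeta> * datum N \<zeta>) \<zeta>)"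

lemma abs_Psym_le:
  assumes \<epsilon>: "\<bar>\<epsilon>\<bar> \<le> 1" and N: "N > 0" and \<xi>: "N \<le> fst \<zeta>" "fst \<zeta> \<le> c * N"
    and \<eta>: "\<bar>snd \<zeta>\<bar> \<le> N\<^sup>2"
  shows "\<bar>Psym \<epsilon> \<zeta>\<bar> \<le> (c ^ 3 + 1) * N ^ 3"
proof -
  have "\<bar>\<epsilon> * (snd \<zeta>)\<^sup>2 / fst \<zeta>\<bar> \<le> 1 * (N\<^sup>2)\<^sup>2 / N"
    unfolding abs_divide abs_mult
    by (intro frac_le mult_mono) (use assms abs_le_square_iff [of "snd \<zeta>" "N\<^sup>2"] in auto)
  also have "\<dots> = N ^ 3" using N by (simp add: power2_eq_square power3_eq_cube)
  finally have "\<bar>\<epsilon> * (snd \<zeta>)\<^sup>2 / fst \<zeta>\<bar> \<le> N ^ 3" .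
  moreover have "\<bar>fst \<zeta> ^ 3\<bar> \<le> (c * N) ^ 3"
    unfolding power_abs using N \<xi> by (intro power_mono) auto
  ultimately show ?thesis
    unfolding Psym_def using abs_triangle_ineq4 [of "fst \<zeta> ^ 3" "\<epsilon> * (snd \<zeta>)\<^sup>2 / fst \<zeta>"]
    by (simp add: power_mult_distrib algebra_simps)
qed

lemma rho_le:
  assumes "0 \<le> \<xi>" "\<xi> \<le> c * N"
  shows "rho \<xi> \<le> c ^ 4 * N ^ 4"
proof -
  have "\<xi> ^ 4 \<le> (c * N) ^ 4" using assms by (intro power_mono) auto
  then show ?thesis using zero_le_power2 [of \<xi>] unfolding rho_def power_mult_distrib by linarith
qed

text \<open>Up to time \<open>N\<^sup>-\<^sup>4\<close> all oscillating factors have phase at most \<open>28 / N\<close> and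
  all damping factors are bounded below, so no cancellation occurs.\<close>
lemma Re_Wsym_triple_ge:
  assumes \<epsilon>: "\<bar>\<epsilon>\<bar> \<le> 1" and N: "N \<ge> 28" and t: "0 \<le> t'" "t' \<le> 1 / N ^ 4"
    and z: "\<zeta> \<in> ebox N" and z1: "\<zeta>1 \<in> dbox N" and z2: "\<zeta>2 \<in> dbox N"
  shows "Re (Wsym \<epsilon> (1 / N ^ 4 - t') \<zeta> * (Wsym \<epsilon> t' \<zeta>1 * Wsym \<epsilon> t' \<zeta>2)) \<ge> exp (- 81) / 2"
proof -
  define \<tau> where "\<tau> = 1 / N ^ 4 - t'"
  define \<theta> where "\<theta> = \<tau> * Psym \<epsilon> \<zeta> + t' * (Psym \<epsilon> \<zeta>1 + Psym \<epsilon> \<zeta>2)"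
  define \<beta> where "\<beta> = \<tau> * rho (fst \<zeta>) + t' * (rho (fst \<zeta>1) + rho (fst \<zeta>2))"
  have \<tau>: "\<tau> \<ge> 0" "\<tau> + t' = 1 / N ^ 4" using t by (simp_all add: \<tau>_def)
  have N0: "N > 0" using N by simp
  have N4: "N ^ 4 > 0" "N ^ 3 > 0" using N0 by auto
  \<comment> \<open>\<open>abs_Psym_le\<close> with c = 3 covers \<open>ebox N\<close> and with c =
    2 covers \<open>dbox N\<close>; 28 = 3^3 + 1 also dominates 9 + 9.\<close>
  have "\<bar>Psym \<epsilon> \<zeta>\<bar> \<le> (3 ^ 3 + 1) * N ^ 3"
    by (rule abs_Psym_le [OF \<epsilon> N0]) (use z N0 in \<open>auto simp: ebox_def\<close>)
  moreover have "\<bar>Psym \<epsilon> \<zeta>1\<bar> \<le> (2 ^ 3 + 1) * N ^ 3" "\<bar>Psym \<epsilon> \<zeta>2\<bar> \<le> (2 ^ 3 + 1) * N ^ 3"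
    by (rule abs_Psym_le [OF \<epsilon> N0]; use z1 z2 N0 in \<open>auto simp: dbox_def\<close>)+
  ultimately have "\<bar>Psym \<epsilon> \<zeta>\<bar> \<le> 28 * N ^ 3" "\<bar>Psym \<epsilon> \<zeta>1 + Psym \<epsilon> \<zeta>2\<bar> \<le> 28 * N ^ 3"
    using N4 by auto
  then have "\<bar>\<theta>\<bar> \<le> \<tau> * (28 * N ^ 3) + t' * (28 * N ^ 3)"
    unfolding \<theta>_def using \<tau> t
    by (intro order_trans [OF abs_triangle_ineq add_mono]) (auto simp: abs_mult intro!: mult_left_mono)
  also have "\<dots> = (\<tau> + t') * (28 * N ^ 3)" by (simp add: algebra_simps)
  also have "\<dots> = 28 / N" unfolding \<tau> using N0 by (simp add: field_simps power4_eq_xxxx power3_eq_cube)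
  also have "\<dots> \<le> 1" using N by simp
  finally have \<theta>: "\<bar>\<theta>\<bar> \<le> 1" .
  \<comment> \<open>The phase is at most 1 < \<pi>/3, so the cosine stays above 1/2.\<close>
  have "cos (pi / 3) \<le> cos \<bar>\<theta>\<bar>"
    by (rule cos_monotone_0_pi_le) (use \<theta> pi_gt3 in auto)
  then have cos: "cos \<theta> \<ge> 1 / 2" by (simp add: cos_60)
  \<comment> \<open>81 = 3^4 also dominates 2^4 + 2^4; the two time weights add up to N^-4.\<close>
  have "rho (fst \<zeta>) \<le> 81 * N ^ 4"
    using rho_le [of "fst \<zeta>" 3 N] z N0 by (auto simp: ebox_def)
  moreover have "rho (fst \<zeta>1) \<le> 16 * N ^ 4" "rho (fst \<zeta>2) \<le> 16 * N ^ 4"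
    using rho_le [of "fst \<zeta>1" 2 N] rho_le [of "fst \<zeta>2" 2 N] z1 z2 N0 by (auto simp: dbox_def)
  ultimately have "rho (fst \<zeta>) \<le> 81 * N ^ 4" "rho (fst \<zeta>1) + rho (fst \<zeta>2) \<le> 81 * N ^ 4"
    using N4(1) by linarith+
  then have "\<beta> \<le> \<tau> * (81 * N ^ 4) + t' * (81 * N ^ 4)"
    unfolding \<beta>_def using \<tau> t by (intro add_mono mult_left_mono)
  also have "\<dots> = (\<tau> + t') * (81 * N ^ 4)" by (simp add: algebra_simps)
  also have "\<dots> = 81" unfolding \<tau> using N4 by simp
  finally have "exp (- 81) \<le> exp (- \<beta>)" by simp
  then have "exp (- 81) * (1 / 2) \<le> exp (- \<beta>) * cos \<theta>"
    using cos by (intro mult_mono) auto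
  also have "\<dots> = Re (exp (\<i> * of_real \<theta> - of_real \<beta>))"
    by (simp add: Re_exp)
  also have "exp (\<i> * of_real \<theta> - of_real \<beta>) = Wsym \<epsilon> \<tau> \<zeta> * (Wsym \<epsilon> t' \<zeta>1 * Wsym \<epsilon> t' \<zeta>2)"
    by (simp add: Wsym_def exp_add [symmetric] \<theta>_def \<beta>_def algebra_simps)
  finally show ?thesis by (simp add: \<tau>_def)
qed

text \<open>The constant collects exp(-81)/2 from the triple product, N^3/4 from the overlap, N^-4
  from the time interval, N^2 from \<Lambda> and 1/(4 \<pi>^2) from the convolution.\<close>

lemma norm_second_iterate_ge:
  assumes \<epsilon>: "\<bar>\<epsilon>\<bar> \<le> 1" and N: "N \<ge> 28" and z: "\<zeta> \<in> ebox N"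
  shows "exp (- 81) / (32 * pi\<^sup>2) * N \<le> cmod (second_iterate \<epsilon> N (1 / N ^ 4) \<zeta>)"
proof -
  define t where "t = 1 / N ^ 4"
  have N0: "N > 0" and t: "t > 0" using N by (auto simp: t_def)
  define f where "f = (\<lambda>t' \<zeta>. Wsym \<epsilon> t' \<zeta> * datum N \<zeta>)"
  define I where "I = (\<lambda>t'. Wsym \<epsilon> (t - t') \<zeta> * Lsym \<zeta> * sqhat (f t') \<zeta>)"
  obtain m where m: "m > 0" "\<And>\<zeta>. cmod (datum N \<zeta>) \<le> m * maj \<zeta>"
    by (rule datum_le_maj [of N]) blast
  obtain K where i: "\<And>\<zeta>. integrable lborel (\<lambda>\<zeta>'. maj (\<zeta> - \<zeta>') * maj \<zeta>')"
    and K: "\<And>\<zeta>. (LINT \<zeta>'|lborel. maj (\<zeta> - \<zeta>') * maj \<zeta>') \<le> K * maj \<zeta>"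
    by (rule maj_conv) blast
  have fm: "(\<lambda>p. f (fst p) (snd p)) \<in> borel_measurable (borel \<Otimes>\<^sub>M borel)"
    unfolding f_def by measurable
  have fm': "f t' \<in> borel_measurable borel" for t' by (rule measurable_section [OF fm])
  have fR: "cmod (f t' \<zeta>') \<le> m * maj \<zeta>'" if "t' \<ge> 0" for t' \<zeta>'
  proof (cases "fst \<zeta>' < N")
    case False
    then have "cmod (Wsym \<epsilon> t' \<zeta>') * cmod (datum N \<zeta>') \<le> 1 * (m * maj \<zeta>')"
      using N that by (intro mult_mono norm_Wsym_le_1 m) auto
    then show ?thesis by (simp add: f_def norm_mult)
  qed (use m maj_pos [of \<zeta>'] in \<open>simp add: f_def datum_eq_0\<close>)
  have \<zeta>2: "fst \<zeta> \<ge> 2" "fst \<zeta> \<ge> N" using z N by (auto simp: ebox_def)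
  have Iint: "set_integrable lborel {0..t} I"
    unfolding I_def
    by (rule set_integrable_duhamel [OF fm norm_sqhat_le [OF fm' fR i K] \<zeta>2(1)]) (use t in auto)
  \<comment> \<open>The symbol of \<Lambda> is constant in t'. Dividing it out, with the
    normalisation, leaves an integral of triple products of propagators, whose real part is bounded
    below.\<close>
  define c where "c = of_real (4 * pi\<^sup>2) / Lsym \<zeta>"
  have "N\<^sup>2 \<le> (fst \<zeta>)\<^sup>2" using \<zeta>2 N0 by (intro power_mono) auto
  also have "\<dots> \<le> cmod (Lsym \<zeta>)"
    using abs_Re_le_cmod [of "Lsym \<zeta>"] by (simp add: Lsym_def)
  finally have L: "N\<^sup>2 \<le> cmod (Lsym \<zeta>)" .
  with zero_less_power [OF N0, of 2] have L0: "cmod (Lsym \<zeta>) > 0" by linarith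
  have ReI: "exp (- 81) / 2 * (N ^ 3 / 4) \<le> Re (c * I t')" if t': "t' \<in> {0..t}" for t'
  proof -
    let ?J = "\<lambda>\<zeta>'. Wsym \<epsilon> (t - t') \<zeta> * (f t' (\<zeta> - \<zeta>') * f t' \<zeta>')"
    \<comment> \<open>A box of area N^3/4 on which both factors of the convolution equal the free
      evolution; outside the full overlap the integrand is 0.\<close>
    let ?Q = "{N..3 * N / 2} \<times> {0..N\<^sup>2 / 2}"
    have Ji: "integrable lborel ?J"
      using t' by (intro integrable_mult_right integrable_conv [OF fm' fR i K]) auto
    have cI: "c * I t' = (LINT \<zeta>'|lborel. ?J \<zeta>')"
      using L0 by (subst integral_mult_right_zero) (simp add: c_def I_def sqhat_def field_simps)
    have "exp (- 81) / 2 * (N ^ 3 / 4) = (LINT \<zeta>'|lborel. exp (- 81) / 2 * indicator ?Q \<zeta>')"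
      using N0 by (subst integral_mult_right_zero, subst integral_indicator_box)
        (auto simp: power3_eq_cube power2_eq_square)
    also have "\<dots> \<le> (LINT \<zeta>'|lborel. Re (?J \<zeta>'))"
    proof (rule integral_mono)
      show "integrable lborel (\<lambda>\<zeta>'. exp (- 81) / 2 * indicator ?Q \<zeta>' :: real)"
        using N0 by (intro integrable_mult_right integrable_indicator_box) auto
      show "integrable lborel (\<lambda>\<zeta>'. Re (?J \<zeta>'))" using Ji by (rule integrable_Re)
      show "exp (- 81) / 2 * indicator ?Q \<zeta>' \<le> Re (?J \<zeta>')" for \<zeta>'
      proof (cases "\<zeta> - \<zeta>' \<in> dbox N \<and> \<zeta>' \<in> dbox N")
        case True
        have "exp (- 81) / 2 * indicator ?Q \<zeta>' \<le> exp (- 81) / (2 :: real)"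
          by (auto simp: indicator_def)
        also have "\<dots> \<le> Re (?J \<zeta>')"
          using Re_Wsym_triple_ge [OF \<epsilon> N _ _ z, of t' "\<zeta> - \<zeta>'" \<zeta>'] True t'
          by (simp add: f_def datum_def t_def)
        finally show ?thesis .
      next
        case False
        have "\<zeta>' \<notin> ?Q"
        proof
          assume "\<zeta>' \<in> ?Q"
          with z N0 have "\<zeta> - \<zeta>' \<in> dbox N \<and> \<zeta>' \<in> dbox N"
            by (auto simp: dbox_def ebox_def mem_Times_iff)
          with False show False by blast
        qed
        then have Q: "indicator ?Q \<zeta>' = (0 :: real)" by simp
        have J: "?J \<zeta>' = 0" using False by (auto simp: f_def datum_def)
        show ?thesis unfolding Q J by simp
      qed
    qed
    also have "\<dots> = Re (c * I t')"
      unfolding cI by (rule integral_Re [OF Ji])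
    finally show ?thesis .
  qed
  have cIint: "set_integrable lborel {0..t} (\<lambda>t'. c * I t')"
    by (rule set_integrable_mult_right) (use Iint in simp)
  have "t * (exp (- 81) / 2 * (N ^ 3 / 4)) = (LINT t':{0..t}|lborel. exp (- 81) / 2 * (N ^ 3 / 4))"
    using t by (simp add: set_lebesgue_integral_def)
  also have "\<dots> \<le> (LINT t':{0..t}|lborel. Re (c * I t'))"
  proof (rule set_integral_mono)
    show "set_integrable lborel {0..t} (\<lambda>t'. exp (- 81) / 2 * (N ^ 3 / 4) :: real)"
      unfolding set_integrable_def
      by (intro integrable_scaleR_left integrable_real_indicator) (auto simp: emeasure_lborel_Icc_eq)
    show "set_integrable lborel {0..t} (\<lambda>t'. Re (c * I t'))"
      using integrable_Re [OF cIint [unfolded set_integrable_def]] by (simp add: set_integrable_def)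
  qed (rule ReI)
  also have "\<dots> = Re (LINT t':{0..t}|lborel. c * I t')"
    unfolding set_lebesgue_integral_def
    using integral_Re [OF cIint [unfolded set_integrable_def]] by simp
  also have "\<dots> \<le> cmod (LINT t':{0..t}|lborel. c * I t')"
    by (rule complex_Re_le_cmod)
  also have "\<dots> = cmod c * cmod (LINT t':{0..t}|lborel. I t')"
    by (simp add: set_integral_mult_right norm_mult)
  also have "cmod c \<le> 4 * pi\<^sup>2 / N\<^sup>2"
    unfolding c_def norm_divide using L N0 by (intro frac_le) (auto simp: norm_mult norm_power)
  finally have "t * (exp (- 81) / 2 * (N ^ 3 / 4)) \<le> 4 * pi\<^sup>2 / N\<^sup>2 * cmod (LINT t':{0..t}|lborel. I t')"
    by (simp add: mult_right_mono)
  also have "(LINT t':{0..t}|lborel. I t') = second_iterate \<epsilon> N t \<zeta>"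
    by (simp add: second_iterate_def I_def f_def)
  finally have "N\<^sup>2 / (4 * pi\<^sup>2) * (t * (exp (- 81) / 2 * (N ^ 3 / 4)))
      \<le> N\<^sup>2 / (4 * pi\<^sup>2) * (4 * pi\<^sup>2 / N\<^sup>2 * cmod (second_iterate \<epsilon> N t \<zeta>))"
    by (intro mult_left_mono) auto
  also have "\<dots> = cmod (second_iterate \<epsilon> N t \<zeta>)" using N0 by simp
  also have "N\<^sup>2 / (4 * pi\<^sup>2) * (t * (exp (- 81) / 2 * (N ^ 3 / 4))) = exp (- 81) / (32 * pi\<^sup>2) * N"
    using N0 by (simp add: t_def power2_eq_square power3_eq_cube power4_eq_xxxx)
  finally show ?thesis by (simp add: t_def)
qed

section \<open>Comparison of the two norms and conclusion\<close>

lemma ebox_borel [measurable]: "ebox N \<in> sets borel"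
  unfolding ebox_def by (rule box_borel)

lemma duhamel_datum:
  assumes "N > 0" "\<zeta> \<in> ebox N"
  shows "duhamel \<epsilon> (\<lambda>\<zeta>. c * datum N \<zeta>) (\<lambda>t' \<zeta>. Wsym \<epsilon> t' \<zeta> * (c * datum N \<zeta>)) t \<zeta> = c\<^sup>2 * (- second_iterate \<epsilon> N t \<zeta>)"
proof -
  have d0: "datum N \<zeta> = 0" using assms by (auto simp: datum_def ebox_def dbox_def)
  have eq: "Wsym \<epsilon> (t - t') \<zeta> * Lsym \<zeta> * sqhat (\<lambda>\<zeta>. Wsym \<epsilon> t' \<zeta> * (c * datum N \<zeta>)) \<zeta> =
      c\<^sup>2 * (Wsym \<epsilon> (t - t') \<zeta> * Lsym \<zeta> * sqhat (\<lambda>\<zeta>. Wsym \<epsilon> t' \<zeta> * datum N \<zeta>) \<zeta>)" for t'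
    using sqhat_scale [of c "\<lambda>\<zeta>. Wsym \<epsilon> t' \<zeta> * datum N \<zeta>" \<zeta>] by (simp add: mult_ac)
  show ?thesis
    unfolding duhamel_def second_iterate_def eq set_integral_mult_right d0 by simp
qed

text \<open>The box has area N^3/8, and 1 + 11 N/4 \<le> 4 N bounds the weight from below because
  its exponent is not positive.\<close>

lemma hnorm_ebox_ge:
  assumes a: "a \<in> Hs s" and M: "\<And>\<zeta>. \<zeta> \<in> ebox N \<Longrightarrow> M \<le> cmod (a \<zeta>)" "M \<ge> 0"
    and N: "N \<ge> 1" and s: "s \<le> 0"
  shows "M\<^sup>2 * (4 * N) powr (2 * s) * (N ^ 3 / 8) \<le> (hnorm s a)\<^sup>2"
proof -
  have "M\<^sup>2 * (4 * N) powr (2 * s) * (N ^ 3 / 8) =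
      (LINT \<zeta>|lborel. M\<^sup>2 * (4 * N) powr (2 * s) * indicator (ebox N) \<zeta>)"
    unfolding ebox_def using N
    by (subst integral_mult_right_zero, subst integral_indicator_box)
       (auto simp: power3_eq_cube power2_eq_square)
  also have "\<dots> \<le> (hnorm s a)\<^sup>2"
    unfolding hnorm_power2
  proof (rule integral_mono [OF _ HsD(2) [OF a]])
    show "integrable lborel (\<lambda>\<zeta>. M\<^sup>2 * (4 * N) powr (2 * s) * indicator (ebox N) \<zeta>)"
      unfolding ebox_def using N by (intro integrable_mult_right integrable_indicator_box) auto
    show "M\<^sup>2 * (4 * N) powr (2 * s) * indicator (ebox N) \<zeta> \<le> jap (fst \<zeta>) powr (2 * s) * (cmod (a \<zeta>))\<^sup>2" for \<zeta>
    proof (cases "\<zeta> \<in> ebox N")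
      case True
      then have "jap (fst \<zeta>) \<le> 4 * N" using N by (auto simp: ebox_def jap_def)
      then have "(4 * N) powr (2 * s) * M\<^sup>2 \<le> jap (fst \<zeta>) powr (2 * s) * (cmod (a \<zeta>))\<^sup>2"
        using s M True by (intro mult_mono powr_mono2' jap_pos power_mono) auto
      then show ?thesis using True by (simp add: mult_ac)
    qed simp
  qed
  finally show ?thesis .
qed

theorem theorem2p2:
  fixes \<epsilon> s :: real
  assumes "\<epsilon> = 1 \<or> \<epsilon> = -1"
    and "s < -1/2"
  shows "\<not> (\<exists>T>0. \<exists>r>0. \<exists>S.
     (\<forall>\<phi>\<in>Hs s. hnorm s \<phi> < r \<longrightarrow>
        S \<phi> \<in> CTH s T \<and> is_solution \<epsilon> T \<phi> (S \<phi>) \<and>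
        (\<forall>v\<in>CTH s T. is_solution \<epsilon> T \<phi> v \<longrightarrow>
           (\<forall>t\<in>{0..T}. hnorm s (\<lambda>\<zeta>. v t \<zeta> - S \<phi> t \<zeta>) = 0))) \<and>
     twice_diff_at0 s T r S)"
proof (rule notI, elim exE conjE)
  fix T r :: real and S
  assume T: "T > 0" and r: "r > 0" and tw: "twice_diff_at0 s T r S"
    and sol: "\<forall>\<phi>\<in>Hs s. hnorm s \<phi> < r \<longrightarrow>
        S \<phi> \<in> CTH s T \<and> is_solution \<epsilon> T \<phi> (S \<phi>) \<and>
        (\<forall>v\<in>CTH s T. is_solution \<epsilon> T \<phi> v \<longrightarrow>
           (\<forall>t\<in>{0..T}. hnorm s (\<lambda>\<zeta>. v t \<zeta> - S \<phi> t \<zeta>) = 0))"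
  have s: "s \<le> 0" and \<epsilon>: "\<bar>\<epsilon>\<bar> \<le> 1" using assms by auto
  have SC: "S \<phi> \<in> CTH s T" if "\<phi> \<in> Hs s" "hnorm s \<phi> < r" for \<phi>
    using sol that by blast
  \<comment> \<open>\<open>C\<close> is fixed before the datum, the box and the time, all of which
    move with N.\<close>
  obtain C where C: "\<And>h a E t \<delta>0. \<lbrakk>h \<in> Hs s; t \<in> {0..T}; E \<in> sets borel; a \<in> Hs s; \<delta>0 > 0;
      \<And>\<delta>::real. \<bar>\<delta>\<bar> < \<delta>0 \<Longrightarrow>
        AE \<zeta> in lborel. \<zeta> \<in> E \<longrightarrow> S (\<lambda>\<zeta>. of_real \<delta> * h \<zeta>) t \<zeta> = of_real (\<delta>\<^sup>2) * a \<zeta>;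
      \<And>\<zeta>. \<zeta> \<notin> E \<Longrightarrow> a \<zeta> = 0\<rbrakk> \<Longrightarrow> hnorm s a \<le> C * (hnorm s h)\<^sup>2"
    by (rule second_order_bound [OF tw SC]) blast+
  obtain K where K: "K > 0" "\<And>\<zeta>. integrable lborel (\<lambda>\<zeta>'. maj (\<zeta> - \<zeta>') * maj \<zeta>')"
    "\<And>\<zeta>. (LINT \<zeta>'|lborel. maj (\<zeta> - \<zeta>') * maj \<zeta>') \<le> K * maj \<zeta>"
    by (rule maj_conv) blast
  define c1 :: real where "c1 = exp (- 81) / (32 * pi\<^sup>2)"
  have c1: "c1 > 0" by (simp add: c1_def)
  \<comment> \<open>N \<ge> 28 makes the phase bound 28/N at most 1, and the other condition makes
    N^-4 an admissible time.\<close>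
  have key: "c1\<^sup>2 * 4 powr (2 * s) / 8 \<le> C\<^sup>2 * N powr (1 + 2 * s)"
    if N: "N \<ge> 28" and NT: "1 / N ^ 4 \<le> T" for N
  proof -
    define t where "t = 1 / N ^ 4"
    have t: "t \<in> {0..T}" using N NT by (simp add: t_def)
    define a where "a = (\<lambda>\<zeta>. indicator (ebox N) \<zeta> * (- second_iterate \<epsilon> N t \<zeta>))"
    define dh :: "real \<Rightarrow> fhat" where "dh = (\<lambda>\<delta> \<zeta>. of_real \<delta> * datum N \<zeta>)"
    define nh where "nh = hnorm s (datum N)"
    have nh: "nh \<ge> 0" by (simp add: nh_def hnorm_nonneg)
    have dhH: "dh \<delta> \<in> Hs s" for \<delta> unfolding dh_def by (intro Hs_scale datum_Hs s)
    obtain m where m: "m > 0" "\<And>\<zeta>. cmod (datum N \<zeta>) \<le> m * maj \<zeta>"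
      by (rule datum_le_maj [of N]) blast
    define R where "R = 1 / (2 * K)"
    have R: "R > 0" "R * K \<le> 1 / 2" using K(1) by (simp_all add: R_def)
    \<comment> \<open>The first bound puts \<delta> \<open>datum N\<close> below R/2
      \<open>maj\<close>, as the Picard iteration asks; the second keeps it in the ball where
      \<open>S\<close> is given.\<close>
    define \<delta>1 where "\<delta>1 = min (R / 2 / m) (r / (nh + 1))"
    have \<delta>1: "\<delta>1 > 0" using R m r nh by (simp add: \<delta>1_def)
    have ex: "\<exists>v\<in>CTH s T. is_solution \<epsilon> T (dh \<delta>) v \<and> (\<forall>\<zeta>\<in>ebox N. v t \<zeta> = of_real (\<delta>\<^sup>2) * a \<zeta>)"
      if \<delta>: "\<bar>\<delta>\<bar> < \<delta>1" for \<delta>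
    proof -
      have dm: "cmod (dh \<delta> \<zeta>) \<le> R / 2 * maj \<zeta>" for \<zeta>
      proof -
        have "cmod (dh \<delta> \<zeta>) \<le> \<bar>\<delta>\<bar> * (m * maj \<zeta>)"
          unfolding dh_def norm_mult using m by (simp add: mult_left_mono)
        also have "\<bar>\<delta>\<bar> * m \<le> R / 2" using \<delta> m(1) by (simp add: \<delta>1_def pos_less_divide_eq)
        then have "\<bar>\<delta>\<bar> * (m * maj \<zeta>) \<le> R / 2 * maj \<zeta>"
          using maj_pos [of \<zeta>] by (simp add: mult.assoc [symmetric] mult_right_mono)
        finally show ?thesis .
      qed
      obtain v where v: "v \<in> CTH s T" "is_solution \<epsilon> T (dh \<delta>) v"
        "\<And>t \<zeta>. fst \<zeta> < 3 * N \<Longrightarrow> v t \<zeta> = duhamel \<epsilon> (dh \<delta>) (\<lambda>t' \<zeta>. Wsym \<epsilon> t' \<zeta> * dh \<delta> \<zeta>) t \<zeta>"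
      proof (rule small_data_solution [OF HsD(1) [OF dhH] _ _ _ R(2) dm K(2,3) s])
        show "dh \<delta> \<zeta> = 0" if "fst \<zeta> < N" for \<zeta> using that by (simp add: dh_def datum_eq_0)
      qed (use N R in auto)
      moreover have "v t \<zeta> = of_real (\<delta>\<^sup>2) * a \<zeta>" if "\<zeta> \<in> ebox N" for \<zeta>
      proof -
        have "fst \<zeta> < 3 * N" using that N by (auto simp: ebox_def)
        then show ?thesis
          using v(3) [of \<zeta> t] duhamel_datum [OF _ that, of \<epsilon> "of_real \<delta>" t] N that
          by (simp add: dh_def a_def)
      qed
      ultimately show ?thesis by blast
    qed
    \<comment> \<open>Membership is read off from one explicit solution, of amplitude \<delta>1/2,
      which spares a direct study of the second iterate.\<close>
    have aH: "a \<in> Hs s"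
    proof -
      obtain v where v: "v \<in> CTH s T" "\<And>\<zeta>. \<zeta> \<in> ebox N \<Longrightarrow> v t \<zeta> = of_real ((\<delta>1 / 2)\<^sup>2) * a \<zeta>"
        using ex [of "\<delta>1 / 2"] \<delta>1 by auto
      have "a = (\<lambda>\<zeta>. of_real (1 / (\<delta>1 / 2)\<^sup>2) * (indicator (ebox N) \<zeta> * v t \<zeta>))"
      proof
        fix \<zeta> show "a \<zeta> = of_real (1 / (\<delta>1 / 2)\<^sup>2) * (indicator (ebox N) \<zeta> * v t \<zeta>)"
          using v(2) [of \<zeta>] \<delta>1 by (cases "\<zeta> \<in> ebox N") (simp_all add: a_def)
      qed
      then show ?thesis
        using Hs_scale [OF Hs_indicator [OF CTH_Hs [OF v(1) t] ebox_borel]] by metis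
    qed
    have "hnorm s a \<le> C * nh\<^sup>2"
      unfolding nh_def
    proof (rule C [OF datum_Hs [OF s] t ebox_borel aH \<delta>1])
      fix \<delta> :: real assume \<delta>: "\<bar>\<delta>\<bar> < \<delta>1"
      obtain v where v: "v \<in> CTH s T" "is_solution \<epsilon> T (dh \<delta>) v"
        "\<And>\<zeta>. \<zeta> \<in> ebox N \<Longrightarrow> v t \<zeta> = of_real (\<delta>\<^sup>2) * a \<zeta>"
        using ex [OF \<delta>] by auto
      have "\<bar>\<delta>\<bar> * (nh + 1) < r" using \<delta> nh by (simp add: \<delta>1_def pos_less_divide_eq)
      then have dr: "hnorm s (dh \<delta>) < r"
        by (simp add: dh_def hnorm_scale nh_def algebra_simps)
      \<comment> \<open>Uniqueness transfers the explicit formula from the constructed solution to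
        \<open>S\<close>, almost everywhere.\<close>
      have "hnorm s (\<lambda>\<zeta>. v t \<zeta> - S (dh \<delta>) t \<zeta>) = 0"
        using sol dhH dr v(1,2) t by blast
      then have "AE \<zeta> in lborel. v t \<zeta> - S (dh \<delta>) t \<zeta> = 0"
        by (rule hnorm_eq_0_AE [OF Hs_diff [OF CTH_Hs [OF v(1) t] CTH_Hs [OF SC [OF dhH dr] t]]])
      then show "AE \<zeta> in lborel. \<zeta> \<in> ebox N \<longrightarrow> S (\<lambda>\<zeta>. of_real \<delta> * datum N \<zeta>) t \<zeta> = of_real (\<delta>\<^sup>2) * a \<zeta>"
        by eventually_elim (use v(3) in \<open>auto simp: dh_def\<close>)
    qed (simp add: a_def)
    then have "(hnorm s a)\<^sup>2 \<le> (C * nh\<^sup>2)\<^sup>2"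
      by (intro power_mono hnorm_nonneg)
    also have "\<dots> = C\<^sup>2 * (nh\<^sup>2)\<^sup>2" by (simp add: power_mult_distrib)
    also have "\<dots> \<le> C\<^sup>2 * (N powr (2 * s) * N ^ 3)\<^sup>2"
      unfolding nh_def using hnorm_datum_le [of N s] N s by (intro mult_left_mono power_mono) auto
    finally have "(hnorm s a)\<^sup>2 \<le> C\<^sup>2 * (N powr (2 * s) * N ^ 3)\<^sup>2" .
    moreover have "(c1 * N)\<^sup>2 * (4 * N) powr (2 * s) * (N ^ 3 / 8) \<le> (hnorm s a)\<^sup>2"
    proof (rule hnorm_ebox_ge [OF aH])
      show "c1 * N \<le> cmod (a \<zeta>)" if "\<zeta> \<in> ebox N" for \<zeta>
        using norm_second_iterate_ge [OF \<epsilon> N that] that by (simp add: a_def t_def c1_def)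
    qed (use N s c1 in auto)
    ultimately have "(c1 * N)\<^sup>2 * (4 * N) powr (2 * s) * (N ^ 3 / 8) \<le> C\<^sup>2 * (N powr (2 * s) * N ^ 3)\<^sup>2"
      by simp
    \<comment> \<open>Both sides are written as multiples of N^(2s+5), which is then
      cancelled.\<close>
    moreover have "(c1 * N)\<^sup>2 * (4 * N) powr (2 * s) * (N ^ 3 / 8) =
        (c1\<^sup>2 * 4 powr (2 * s) / 8) * (N powr (2 * s) * N ^ 5)"
      using N by (simp add: powr_mult power_mult_distrib flip: power_add)
    moreover have "C\<^sup>2 * (N powr (2 * s) * N ^ 3)\<^sup>2 = (C\<^sup>2 * N powr (1 + 2 * s)) * (N powr (2 * s) * N ^ 5)"
      using N by (simp add: powr_add power_mult_distrib power2_eq_square flip: power_add power_Suc)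
    ultimately show ?thesis
      using N by simp
  qed
  \<comment> \<open>Here s < -1/2 enters: the exponent 1 + 2 s is negative.\<close>
  have "((\<lambda>N. C\<^sup>2 * N powr (1 + 2 * s)) \<longlongrightarrow> C\<^sup>2 * 0) at_top"
    using assms(2) by (intro tendsto_mult tendsto_const tendsto_neg_powr filterlim_ident) auto
  then have "\<forall>\<^sub>F N in at_top. C\<^sup>2 * N powr (1 + 2 * s) < c1\<^sup>2 * 4 powr (2 * s) / 8"
    using c1 by (intro order_tendstoD(2) [where y = "C\<^sup>2 * 0"]) auto
  moreover have "\<forall>\<^sub>F N in at_top. N \<ge> (28 :: real)" by (rule eventually_ge_at_top)
  moreover have "\<forall>\<^sub>F N :: real in at_top. 1 / N ^ 4 \<le> T"
  proof -
    have "((\<lambda>N :: real. 1 / N ^ 4) \<longlongrightarrow> 0) at_top"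
      by (intro tendsto_divide_0 [OF tendsto_const] filterlim_at_top_imp_at_infinity filterlim_pow_at_top filterlim_ident) simp
    then have "\<forall>\<^sub>F N :: real in at_top. 1 / N ^ 4 < T" by (rule order_tendstoD) (rule T)
    then show ?thesis by eventually_elim simp
  qed
  ultimately have "\<forall>\<^sub>F N :: real in at_top. False"
    by eventually_elim (use key in force)
  then show False by simp
qed

end
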